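(* Let $\mathfrak{A}$ be a $C^*$-algebra, let $E$, $H$ and $K$ be Hilbert $\mathfrak{A}$-modules, and let $T\in\mathcal{L}(E,K)$ and $T'\in\mathcal{L}(H,K)$. Then the following two statements are equivalent: (i) $T'(T')^*\le\lambda TT^*$ for some $\lambda>0$; (ii) there exists $\mu>0$ such that $\Vert (T')^*z\Vert\le\mu\Vert T^*z\Vert$ for all $z\in K$.
   Context: Hilbert $\mathfrak{A}$-modules are right modules over the (not necessarily unital) $C^*$-algebra $\mathfrak{A}$ with an $\mathfrak{A}$-valued inner product $\langle\cdot,\cdot\rangle$ that is conjugate-linear in the first and linear (over $\mathbb{C}$ and $\mathfrak{A}$) in the second variable, complete in the norm $\Vert x\Vert=\sqrt{\Vert\langle x,x\rangle\Vert}$. $\mathcal{L}(H,K)$ denotes the set of adjointable operators $T:H\to K$, i.e. those for which there is $T^*:K\to H$ with $\langle Tx,y\rangle=\langle x,T^*y\rangle$ for all $x\in H$, $y\in K$. $\mathcal{L}(K)=\mathcal{L}(K,K)$ is a $C^*$-algebra, and $\le$ denotes its usual order: $A\le B$ means $B-A$ is a positive element of $\mathcal{L}(K)$. *)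

theory Defs
  imports "HOL-Analysis.Analysis"
begin

class complex_vector = real_vector +
  fixes scaleC :: "complex \<Rightarrow> 'a \<Rightarrow> 'a" (infixr \<open>*\<^sub>C\<close> 75)
  assumes scaleC_add_right: "c *\<^sub>C (x + y) = c *\<^sub>C x + c *\<^sub>C y"
    and scaleC_add_left: "(c + d) *\<^sub>C x = c *\<^sub>C x + d *\<^sub>C x"
    and scaleC_scaleC: "c *\<^sub>C (d *\<^sub>C x) = (c * d) *\<^sub>C x"
    and scaleC_one: "1 *\<^sub>C x = x"
    and scaleR_scaleC: "r *\<^sub>R x = complex_of_real r *\<^sub>C x"

text \<open>No unit is assumed: \<open>real_normed_algebra\<close> is the class of not necessarily unital
  algebras with a submultiplicative norm.\<close>

class cstar_algebra = complex_vector + real_normed_algebra + banach +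
  fixes star :: "'a \<Rightarrow> 'a"
  assumes mult_scaleC_left: "(c *\<^sub>C x) * y = c *\<^sub>C (x * y)"
    and mult_scaleC_right: "x * (c *\<^sub>C y) = c *\<^sub>C (x * y)"
    and norm_scaleC: "norm (c *\<^sub>C x) = cmod c * norm x"
    and star_add: "star (x + y) = star x + star y"
    and star_scaleC: "star (c *\<^sub>C x) = cnj c *\<^sub>C star x"
    and star_mult: "star (x * y) = star y * star x"
    and star_star: "star (star x) = x"
    and cstar_identity: "norm (star x * x) = (norm x)\<^sup>2"

text \<open>The pair \<open>(a, \<alpha>)\<close> stands for the element \<open>a + \<alpha>1\<close> of the unitization; its unit is
  \<open>(0, 1)\<close>.\<close>

definition unitization_mult ::
    "'a::cstar_algebra \<times> complex \<Rightarrow> 'a \<times> complex \<Rightarrow> 'a \<times> complex" where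
  "unitization_mult u v =
     (fst u * fst v + snd u *\<^sub>C fst v + snd v *\<^sub>C fst u, snd u * snd v)"

text \<open>The spectrum is always taken in the unitization. If the algebra already has a unit, this
  only adds the point \<open>0\<close> to the spectrum, so positivity is not affected.\<close>

definition cstar_spectrum :: "'a::cstar_algebra \<Rightarrow> complex set" where
  "cstar_spectrum a =
     {z. \<not> (\<exists>u. unitization_mult u (a, - z) = (0, 1) \<and> unitization_mult (a, - z) u = (0, 1))}"

definition cstar_positive :: "'a::cstar_algebra \<Rightarrow> bool" where
  "cstar_positive a \<longleftrightarrow> star a = a \<and> cstar_spectrum a \<subseteq> \<real>\<^sub>\<ge>\<^sub>0"

text \<open>\<open>act x a\<close> is the right action \<open>x a\<close> and \<open>ip x y\<close> is the inner product of \<open>x\<close> and \<open>y\<close>.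
  Completeness is part of the class \<open>banach\<close>, whose norm is tied to \<open>ip\<close> by the axiom
  \<open>norm_eq_sqrt_ip\<close>. Conjugate linearity in the first variable follows from linearity in the
  second and \<open>star_ip\<close>.\<close>

locale hilbert_module =
  fixes act :: "'h::{complex_vector,banach} \<Rightarrow> 'a::cstar_algebra \<Rightarrow> 'h"
    and ip :: "'h \<Rightarrow> 'h \<Rightarrow> 'a"
  assumes act_add_left: "act (x + y) a = act x a + act y a"
    and act_add_right: "act x (a + b) = act x a + act x b"
    and act_mult: "act x (a * b) = act (act x a) b"
    and act_scaleC_left: "act (c *\<^sub>C x) a = c *\<^sub>C act x a"
    and act_scaleC_right: "act x (c *\<^sub>C a) = c *\<^sub>C act x a"
    and ip_add_right: "ip x (y + z) = ip x y + ip x z"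
    and ip_scaleC_right: "ip x (c *\<^sub>C y) = c *\<^sub>C ip x y"
    and ip_act_right: "ip x (act y a) = ip x y * a"
    and star_ip: "star (ip x y) = ip y x"
    and ip_self_positive: "cstar_positive (ip x x)"
    and ip_self_eq_zero: "ip x x = 0 \<Longrightarrow> x = 0"
    and norm_eq_sqrt_ip: "norm x = sqrt (norm (ip x x))"

text \<open>The operators below act between Hilbert modules with inner products \<open>ipH\<close> and \<open>ipK\<close>. A map
  with an adjoint is automatically linear over the complex numbers and over the algebra, and
  bounded, so no such condition is imposed. An adjoint is unique, which makes the definite
  description in \<open>adjoint_op\<close> meaningful for adjointable operators.\<close>

definition is_adjoint ::
    "('h \<Rightarrow> 'h \<Rightarrow> 'a) \<Rightarrow> ('k \<Rightarrow> 'k \<Rightarrow> 'a) \<Rightarrow> ('h \<Rightarrow> 'k) \<Rightarrow> ('k \<Rightarrow> 'h) \<Rightarrow> bool" where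
  "is_adjoint ipH ipK T S \<longleftrightarrow> (\<forall>x y. ipK (T x) y = ipH x (S y))"

definition adjointable_ops ::
    "('h \<Rightarrow> 'h \<Rightarrow> 'a) \<Rightarrow> ('k \<Rightarrow> 'k \<Rightarrow> 'a) \<Rightarrow> ('h \<Rightarrow> 'k) set" where
  "adjointable_ops ipH ipK = {T. \<exists>S. is_adjoint ipH ipK T S}"

definition adjoint_op ::
    "('h \<Rightarrow> 'h \<Rightarrow> 'a) \<Rightarrow> ('k \<Rightarrow> 'k \<Rightarrow> 'a) \<Rightarrow> ('h \<Rightarrow> 'k) \<Rightarrow> 'k \<Rightarrow> 'h" where
  "adjoint_op ipH ipK T = (THE S. is_adjoint ipH ipK T S)"

text \<open>Spectrum, positivity and order in the unital C*-algebra of adjointable operators on one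
  module, whose product is composition and whose unit is the identity map.\<close>

definition op_spectrum ::
    "('k::complex_vector \<Rightarrow> 'k \<Rightarrow> 'a) \<Rightarrow> ('k \<Rightarrow> 'k) \<Rightarrow> complex set" where
  "op_spectrum ip A =
     {z. \<not> (\<exists>R \<in> adjointable_ops ip ip.
              R \<circ> (\<lambda>x. A x - z *\<^sub>C x) = id \<and> (\<lambda>x. A x - z *\<^sub>C x) \<circ> R = id)}"

definition op_positive :: "('k::complex_vector \<Rightarrow> 'k \<Rightarrow> 'a) \<Rightarrow> ('k \<Rightarrow> 'k) \<Rightarrow> bool" where
  "op_positive ip A \<longleftrightarrow>
     A \<in> adjointable_ops ip ip \<and> adjoint_op ip ip A = A \<and> op_spectrum ip A \<subseteq> \<real>\<^sub>\<ge>\<^sub>0"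

definition op_le ::
    "('k::complex_vector \<Rightarrow> 'k \<Rightarrow> 'a) \<Rightarrow> ('k \<Rightarrow> 'k) \<Rightarrow> ('k \<Rightarrow> 'k) \<Rightarrow> bool" where
  "op_le ip A B \<longleftrightarrow> op_positive ip (\<lambda>x. B x - A x)"

end

theory Submission
  imports Defs
begin

text \<open>Let \<open>S\<close> and \<open>S'\<close> be the adjoints of \<open>T\<close> and \<open>T'\<close>, and put \<open>B = T S\<close>, \<open>A = T' S'\<close>.

From (i) to (ii): a positive operator has a positive quadratic form (\<open>pos_elem_ip_posop\<close>), so
\<open>\<langle>S'z, S'z\<rangle> + \<langle>z, (\<lambda>B - A)z\<rangle> = \<lambda>\<langle>Sz, Sz\<rangle>\<close> is a sum of two positive elements of the algebra.
The norm is monotone on positive elements, hence \<open>\<parallel>S'z\<parallel>\<^sup>2 \<le> \<lambda> \<parallel>Sz\<parallel>\<^sup>2\<close>.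

From (ii) to (i): take \<open>\<lambda> > \<mu>\<^sup>2\<close> and \<open>s > 0\<close>; it must be shown that \<open>\<lambda>B - A + s\<close> is invertible.
The operator \<open>C = \<lambda>B + s\<close> is invertible because \<open>B\<close> is positive. Invertibility of
\<open>C - T' S'\<close> on \<open>K\<close> is equivalent to invertibility of \<open>1 - W\<close> on \<open>H\<close>, where
\<open>W = S' C\<^sup>-\<^sup>1 T'\<close> (\<open>bij_diff_comp_of_bij\<close>). With \<open>u = C\<^sup>-\<^sup>1 T' x\<close>, hypothesis (ii) and monotonicity
of the norm give
\<open>\<lambda> \<parallel>Wx\<parallel>\<^sup>2 \<le> \<mu>\<^sup>2 \<lambda> \<parallel>Su\<parallel>\<^sup>2 \<le> \<mu>\<^sup>2 \<parallel>\<langle>u, Cu\<rangle>\<parallel> = \<mu>\<^sup>2 \<parallel>\<langle>Wx, x\<rangle>\<parallel>\<close>, so \<open>\<parallel>W\<parallel> \<le> \<mu>\<^sup>2/\<lambda> < 1\<close>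
and the Neumann series applies.

Both directions rest on the elementary order theory of self-adjoint operators, developed
without functional calculus. Its one analytic ingredient is that a symmetric operator \<open>h\<close>
attains its norm spectrally: \<open>\<parallel>h\<parallel> - h\<close> and \<open>\<parallel>h\<parallel> + h\<close> are not both invertible if \<open>h \<noteq> 0\<close>
(\<open>symm_contraction_norm_less_1\<close>). If they were, the resolvent of the normalized operator would
be bounded on the unit circle, and averaging over roots of unity would make its powers
tend to zero, whereas \<open>\<parallel>h\<^sup>2\<parallel> = \<parallel>h\<parallel>\<^sup>2\<close> keeps the powers
with exponent \<open>2\<^sup>k\<close> of norm 1. This turns the spectral definition
of positivity into the norm inequality \<open>\<parallel>r - h\<parallel> \<le> r\<close> for any bound \<open>r\<close> of \<open>h\<close>
(\<open>posop_norm_diff_le\<close>, \<open>posop_of_norm_diff_le\<close>), from which sums, scaling and monotonicity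
of the norm follow by the triangle inequality.

The theory is set up for forms satisfying the Cauchy-Schwarz inequality, because it has two
instances of this kind. For the algebra acting on itself by left multiplication, Cauchy-Schwarz
is submultiplicativity of the norm, and the resulting order facts about positive elements imply
the Cauchy-Schwarz inequality of a Hilbert module (\<open>ip_Cauchy_Schwarz\<close>). This makes
operators on the module the second instance.\<close>

section \<open>Complex scalars, the involution, and roots of unity\<close>

lemma scaleC_zero_right [simp]: "c *\<^sub>C (0::'a::complex_vector) = 0"
  using scaleC_add_right[of c 0 0] by simp

lemma scaleC_zero_left [simp]: "0 *\<^sub>C (x::'a::complex_vector) = 0"
  using scaleC_add_left[of 0 0 x] by simp

lemma scaleC_minus_right: "c *\<^sub>C (- x) = - (c *\<^sub>C (x::'a::complex_vector))"
  using scaleC_add_right[of c x "- x"] by (simp add: minus_unique)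

lemma scaleC_minus_left: "(- c) *\<^sub>C (x::'a::complex_vector) = - (c *\<^sub>C x)"
  using scaleC_add_left[of c "- c" x] by (simp add: minus_unique)

lemma scaleC_diff_right: "c *\<^sub>C (x - y) = c *\<^sub>C x - c *\<^sub>C (y::'a::complex_vector)"
  using scaleC_add_right[of c x "- y"] by (simp add: scaleC_minus_right)

lemma scaleC_diff_left: "(c - d) *\<^sub>C x = c *\<^sub>C x - d *\<^sub>C (x::'a::complex_vector)"
  using scaleC_add_left[of c "- d" x] by (simp add: scaleC_minus_left)

lemma scaleC_sum_right: "c *\<^sub>C (\<Sum>i\<in>I. f i) = (\<Sum>i\<in>I. c *\<^sub>C (f i::'a::complex_vector))"
  by (induction I rule: infinite_finite_induct) (simp_all add: scaleC_add_right)

lemma scaleC_sum_left: "(\<Sum>i\<in>I. f i) *\<^sub>C (x::'a::complex_vector) = (\<Sum>i\<in>I. f i *\<^sub>C x)"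
  by (induction I rule: infinite_finite_induct) (simp_all add: scaleC_add_left)

lemma star_zero [simp]: "star (0::'a::cstar_algebra) = 0"
  using star_add[of "0::'a" 0] by simp

lemma star_minus: "star (- a) = - star (a::'a::cstar_algebra)"
  using star_add[of a "- a"] by (simp add: minus_unique)

lemma star_diff: "star (a - b) = star a - star (b::'a::cstar_algebra)"
  using star_add[of a "- b"] by (simp add: star_minus)

text \<open>The C*-identity gives \<open>\<parallel>b\<parallel>\<^sup>2 \<le> \<parallel>b\<^sup>*\<parallel> \<parallel>b\<parallel>\<close>, hence \<open>\<parallel>b\<parallel> \<le> \<parallel>b\<^sup>*\<parallel>\<close> for every \<open>b\<close>, in particular for
\<open>a\<close> and for \<open>a\<^sup>*\<close>.\<close>

lemma norm_star [simp]: "norm (star a) = norm (a::'a::cstar_algebra)"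
proof -
  have "norm b \<le> norm (star b)" for b :: 'a
  proof (cases "b = 0")
    case False
    have "norm b * norm b \<le> norm (star b) * norm b"
      using cstar_identity[of b] norm_mult_ineq[of "star b" b] by (simp add: power2_eq_square)
    then show ?thesis using False by simp
  qed simp
  from this[of a] this[of "star a"] show ?thesis by (simp add: star_star)
qed

text \<open>The weights that extract the middle coefficient of a polynomial of degree below \<open>2 m\<close> from
its values at the \<open>2 m\<close>-th roots of unity: the alternating signs are the \<open>m\<close>-th powers
of the roots. The values are paired at neighbouring roots, so that only differences occur.\<close>

lemma alternating_root_sum:
  assumes "m > 0" "j < 2 * m"
  shows "(\<Sum>k<m. cis (pi / m) ^ (2 * k * j) - cis (pi / m) ^ ((2 * k + 1) * j))
    = (if j = m then of_nat (2 * m) else 0)"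
proof -
  define w where "w = cis (pi / m)"
  have wm: "w ^ m = -1" using assms by (simp add: w_def Complex.DeMoivre)
  have w2m: "w ^ (2 * m) = 1" by (subst mult.commute) (simp add: power_mult wm)
  have "(\<Sum>k<m. w ^ (2 * k * j) - w ^ ((2 * k + 1) * j)) = (\<Sum>k<m. (1 - w ^ j) * (w ^ (2 * j)) ^ k)"
    by (intro sum.cong refl) (simp add: algebra_simps flip: power_mult power_add)
  also have "\<dots> = (1 - w ^ j) * (\<Sum>k<m. (w ^ (2 * j)) ^ k)" by (simp add: sum_distrib_left)
  also have "\<dots> = (if j = m then of_nat (2 * m) else 0)"
  proof (cases "j = m \<or> j = 0")
    case True
    moreover have "w ^ (2 * m) = 1" by (simp add: w2m)
    ultimately show ?thesis using wm assms by auto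
  next
    case False
    have "w ^ (2 * j) = exp (2 * of_real pi * \<i> * of_nat j / of_nat m)"
      unfolding w_def Complex.DeMoivre unfolding cis_conv_exp by (simp add: algebra_simps)
    moreover have "\<not> m dvd j"
    proof
      assume "m dvd j"
      then obtain q where q: "j = m * q" by (elim dvdE)
      with assms have "q < 2" by simp
      then have "q = 0 \<or> q = 1" by linarith
      then show False using False q by auto
    qed
    ultimately have ne: "w ^ (2 * j) \<noteq> 1" using complex_root_unity_eq_1[of m j] assms by simp
    have "(w ^ (2 * j)) ^ m = (w ^ (2 * m)) ^ j" by (simp add: mult_ac flip: power_mult)
    then have "(w ^ (2 * j)) ^ m = 1" by (simp add: w2m)
    then show ?thesis using False geometric_sum[OF ne, of m] by simp
  qed
  finally show ?thesis by (simp add: w_def)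
qed

section \<open>Forms with values in a C*-algebra\<close>

text \<open>The common setting of the algebra acting on itself and of a Hilbert module. The Cauchy-Schwarz
inequality is an axiom here because, for a Hilbert module, its proof uses the theory of this locale
for the algebra.\<close>

locale cstar_form =
  fixes ip :: "'x::{complex_vector,banach} \<Rightarrow> 'x \<Rightarrow> 'a::cstar_algebra"
  assumes ip_add_right: "ip x (y + z) = ip x y + ip x z"
    and ip_scaleC_right: "ip x (c *\<^sub>C y) = c *\<^sub>C ip x y"
    and star_ip: "star (ip x y) = ip y x"
    and norm_ip_self: "norm (ip x x) = (norm x)\<^sup>2"
    and norm_ip_le: "norm (ip x y) \<le> norm x * norm y"
begin

lemma ip_add_left: "ip (x + y) z = ip x z + ip y z"
  by (metis ip_add_right star_add star_ip)

lemma ip_scaleC_left: "ip (c *\<^sub>C x) y = cnj c *\<^sub>C ip x y"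
  by (metis ip_scaleC_right star_scaleC star_ip)

lemma ip_scaleR_right: "ip x (r *\<^sub>R y) = r *\<^sub>R ip x y"
  by (simp add: scaleR_scaleC ip_scaleC_right)

lemma ip_scaleR_left: "ip (r *\<^sub>R x) y = r *\<^sub>R ip x y"
  by (simp add: scaleR_scaleC ip_scaleC_left)

lemma ip_diff_right: "ip x (y - z) = ip x y - ip x z"
  by (metis add_diff_cancel_right' diff_add_cancel ip_add_right)

lemma ip_diff_left: "ip (x - y) z = ip x z - ip y z"
  by (metis add_diff_cancel_right' diff_add_cancel ip_add_left)

lemmas ip_simps = ip_add_left ip_add_right ip_diff_left ip_diff_right
  ip_scaleC_left ip_scaleC_right ip_scaleR_left ip_scaleR_right

lemma ip_right_eqI:
  assumes "\<And>z. ip z x = ip z y" shows "x = y"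
proof -
  have "ip (x - y) (x - y) = 0" using assms by (simp add: ip_diff_right)
  then have "norm (x - y) = 0" using norm_ip_self[of "x - y"] by simp
  then show ?thesis by simp
qed

lemma norm_scaleC_vec: "norm (c *\<^sub>C x) = cmod c * norm (x::'x)"
proof (rule power2_eq_imp_eq)
  show "(norm (c *\<^sub>C x))\<^sup>2 = (cmod c * norm x)\<^sup>2"
    unfolding power_mult_distrib norm_ip_self[symmetric]
    by (simp add: ip_simps norm_scaleC power2_eq_square mult.assoc)
qed simp_all

definition symm :: "('x \<Rightarrow> 'x) \<Rightarrow> bool" where
  "symm h \<longleftrightarrow> (\<forall>x y. ip (h x) y = ip x (h y))"

lemma symmD: "symm h \<Longrightarrow> ip (h x) y = ip x (h y)"
  by (simp add: symm_def)

lemma symm_add: "symm h \<Longrightarrow> symm k \<Longrightarrow> symm (\<lambda>x. h x + k x)"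
  by (simp add: symm_def ip_simps)

lemma symm_diff: "symm h \<Longrightarrow> symm k \<Longrightarrow> symm (\<lambda>x. h x - k x)"
  by (simp add: symm_def ip_simps)

lemma symm_scaleR: "symm h \<Longrightarrow> symm (\<lambda>x. r *\<^sub>R h x)"
  by (simp add: symm_def ip_simps)

lemma symm_scaleR_id: "symm (\<lambda>x. r *\<^sub>R x)"
  by (simp add: symm_def ip_simps)

lemma symm_funpow: "symm h \<Longrightarrow> symm (h ^^ n)"
  by (induction n) (simp_all add: symm_def funpow_swap1)

lemma symm_maps_add: "symm h \<Longrightarrow> h (x + y) = h x + h y"
  by (rule ip_right_eqI) (simp add: symmD[symmetric] ip_simps)

lemma symm_maps_diff: "symm h \<Longrightarrow> h (x - y) = h x - h y"
  by (rule ip_right_eqI) (simp add: symmD[symmetric] ip_simps)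

lemma symm_maps_scaleC: "symm h \<Longrightarrow> h (c *\<^sub>C x) = c *\<^sub>C h x"
  by (rule ip_right_eqI) (simp add: symmD[symmetric] ip_simps)

lemma symm_maps_sum: "symm h \<Longrightarrow> h (\<Sum>i\<in>I. f i) = (\<Sum>i\<in>I. h (f i))"
  using symm_maps_diff[of h 0 0]
  by (induction I rule: infinite_finite_induct) (simp_all add: symm_maps_add)

text \<open>The Hellinger-Toeplitz theorem. The sets \<open>{x. \<parallel>h x\<parallel> \<le> n}\<close> are closed, because the bound on
\<open>\<parallel>h x\<parallel>\<close> can be tested by the continuous maps \<open>ip (h y)\<close>, and they cover the space; by the
Baire category theorem one of them contains a ball.\<close>

lemma symm_bounded_linear:
  assumes "symm h" shows "bounded_linear h"
proof -
  define A where "A n = {x. norm (h x) \<le> real n}" for n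
  have A_eq: "A n = (\<Inter>y. {x. norm (ip (h y) x) \<le> real n * norm y})" for n
  proof (intro equalityI subsetI)
    fix x assume "x \<in> A n"
    then have "norm (ip y (h x)) \<le> real n * norm y" for y
      using norm_ip_le[of y "h x"] mult_right_mono[of "norm (h x)" "real n" "norm y"]
      by (simp add: A_def mult.commute)
    then show "x \<in> (\<Inter>y. {x. norm (ip (h y) x) \<le> real n * norm y})"
      using assms by (simp add: symmD)
  next
    fix x assume "x \<in> (\<Inter>y. {x. norm (ip (h y) x) \<le> real n * norm y})"
    then have "norm (ip (h (h x)) x) \<le> real n * norm (h x)" by simp
    then have "norm (h x) * norm (h x) \<le> real n * norm (h x)"
      using assms norm_ip_self[of "h x"] by (simp add: symmD power2_eq_square)
    then show "x \<in> A n" by (cases "h x = 0") (simp_all add: A_def)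
  qed
  have cont: "continuous_on UNIV (ip y)" for y
  proof -
    have "bounded_linear (ip y)"
      by (rule bounded_linear_intro[where K = "norm y"])
        (use norm_ip_le[of y] in \<open>simp_all add: ip_simps mult.commute\<close>)
    then show ?thesis by (rule linear_continuous_on)
  qed
  have closed_A: "closed (A n)" for n
    unfolding A_eq by (intro closed_INT ballI closed_Collect_le continuous_intros cont)
  have "\<exists>n. interior (A n) \<noteq> {}"
  proof (rule ccontr)
    assume *: "\<not> ?thesis"
    have "euclidean interior_of \<Union>(range A) = {}"
      using Met_TC.metric_Baire_category_alt[of "range A"] * closed_A
      by (auto simp: complete_UNIV)
    moreover have "\<Union>(range A) = UNIV"
      by (auto simp: A_def real_arch_simple)
    ultimately show False by (simp add: interior_of_eq)
  qed
  then obtain n x0 where "x0 \<in> interior (A n)" by blast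
  then obtain e where e: "e > 0" "ball x0 e \<subseteq> A n" by (meson mem_interior)
  have small: "norm (h x) \<le> 2 * real n" if "norm x < e" for x
  proof -
    have "x0 + x \<in> A n" "x0 \<in> A n" using e that by (auto simp: dist_norm)
    then have "norm (h (x0 + x)) \<le> n" "norm (h x0) \<le> n" by (auto simp: A_def)
    moreover have "h x = h (x0 + x) - h x0" by (simp add: symm_maps_add assms)
    ultimately show ?thesis using norm_triangle_ineq4[of "h (x0 + x)" "h x0"] by simp
  qed
  have scaleR: "h (r *\<^sub>R x) = r *\<^sub>R h x" for r x
    by (simp add: scaleR_scaleC symm_maps_scaleC assms)
  show ?thesis
  proof (rule bounded_linear_intro[where K = "4 * real n / e"])
    fix x
    show "norm (h x) \<le> norm x * (4 * real n / e)"
    proof (cases "x = 0")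
      case True
      then show ?thesis using symm_maps_diff[OF assms, of 0 0] by simp
    next
      case False
      define r where "r = e / (2 * norm x)"
      have "r > 0" "norm (r *\<^sub>R x) < e" using False e by (simp_all add: r_def)
      then have "r * norm (h x) \<le> 2 * real n" using small[of "r *\<^sub>R x"] by (simp add: scaleR)
      then show ?thesis using False e by (simp add: r_def field_simps)
    qed
  qed (simp_all add: symm_maps_add assms scaleR)
qed

lemma symm_bound_ex:
  assumes "symm h" obtains r where "r > 0" "\<And>x. norm (h x) \<le> r * norm x"
  using bounded_linear.pos_bounded[OF symm_bounded_linear[OF assms]]
  by (metis mult.commute)

section \<open>Invertibility of shifted symmetric operators\<close>

text \<open>The Neumann series in the form of the Banach fixed point theorem: \<open>w x - W x = y\<close> says that
\<open>x\<close> is a fixed point of the contraction \<open>x \<mapsto> (W x + y) / w\<close>.\<close>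

lemma bij_scaleC_diff:
  fixes W :: "'x \<Rightarrow> 'x"
  assumes W: "bounded_linear W" and c: "0 \<le> c" "\<And>x. norm (W x) \<le> c * norm x"
    and w: "c < cmod w"
  shows "bij (\<lambda>x. w *\<^sub>C x - W x)"
  unfolding bij_iff
proof
  fix y
  interpret W: bounded_linear W by (rule W)
  define f where "f x = inverse w *\<^sub>C (W x + y)" for x
  have w0: "w \<noteq> 0" using c w by auto
  have iff: "f x = x \<longleftrightarrow> w *\<^sub>C x - W x = y" for x
  proof
    assume "f x = x"
    then have "w *\<^sub>C x = w *\<^sub>C f x" by simp
    then show "w *\<^sub>C x - W x = y" using w0 by (simp add: f_def scaleC_scaleC scaleC_one)
  next
    assume "w *\<^sub>C x - W x = y"
    then have "W x + y = w *\<^sub>C x" by (simp add: algebra_simps)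
    then show "f x = x" using w0 by (simp add: f_def scaleC_scaleC scaleC_one)
  qed
  have "\<exists>!x. f x = x"
  proof (rule banach_fix_type[where c = "c / cmod w" and f = f])
    show "\<forall>x y. dist (f x) (f y) \<le> c / cmod w * dist x y"
    proof (intro allI)
      fix u v
      have "f u - f v = inverse w *\<^sub>C W (u - v)"
        by (simp add: f_def W.diff flip: scaleC_diff_right)
      then have "dist (f u) (f v) = inverse (cmod w) * norm (W (u - v))"
        by (simp add: dist_norm norm_scaleC_vec norm_inverse)
      also have "\<dots> \<le> inverse (cmod w) * (c * norm (u - v))"
        by (intro mult_left_mono c) simp
      finally show "dist (f u) (f v) \<le> c / cmod w * dist u v"
        by (simp add: dist_norm field_simps)
    qed
    have "0 < cmod w" using w0 by simp
    then show "c / cmod w < 1" using w by (simp only: divide_less_eq_1_pos)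
  qed (use c in simp)
  then show "\<exists>!x. w *\<^sub>C x - W x = y" unfolding iff .
qed

lemma bij_scaleR_diff:
  fixes W :: "'x \<Rightarrow> 'x"
  assumes "bounded_linear W" "0 \<le> c" "\<And>x. norm (W x) \<le> c * norm x" "c < s"
  shows "bij (\<lambda>x. s *\<^sub>R x - W x)"
  using bij_scaleC_diff[OF assms(1,2), of "complex_of_real s"] assms
  by (simp add: scaleR_scaleC)

lemma symm_inv:
  assumes "symm h" "bij h" shows "symm (inv h)"
  unfolding symm_def
proof (intro allI)
  fix x y
  have *: "h (inv h z) = z" for z using assms(2) by (simp add: bij_is_surj surj_f_inv_f)
  show "ip (inv h x) y = ip x (inv h y)"
    using symmD[OF assms(1), of "inv h x" "inv h y"] by (simp add: *)
qed

lemma symm_bij_bounded_below: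
  assumes "symm h" "bij h"
  obtains c where "c > 0" "\<And>x. c * norm x \<le> norm (h x)"
proof -
  obtain r where r: "r > 0" "\<And>x. norm (inv h x) \<le> r * norm x"
    using symm_bound_ex[OF symm_inv[OF assms]] by metis
  show ?thesis
  proof
    show "1 / r > 0" using r by simp
    fix x
    have "inv h (h x) = x" using assms(2) by (simp add: bij_is_inj)
    then show "1 / r * norm x \<le> norm (h x)" using r(1) r(2)[of "h x"] by (simp add: field_simps)
  qed
qed

text \<open>The two cross terms of \<open>\<langle>(k + it)x, (k + it)x\<rangle>\<close> cancel by symmetry of \<open>k\<close>. Thus \<open>\<parallel>k + it\<parallel>\<close> grows
only like \<open>\<surd>(\<parallel>k\<parallel>\<^sup>2 + t\<^sup>2)\<close>, which stays below \<open>\<bar>b + t\<bar>\<close> if \<open>t\<close> is large and has the sign of \<open>b\<close>.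
Applied to \<open>k - ib = (k + it) - i(b + t)\<close>, this shows that non-real numbers are not in the
spectrum, quantitatively in the next lemma and by a Neumann series in \<open>bij_nonreal_diff\<close>.\<close>

lemma norm_symm_add_imaginary:
  assumes "symm k"
  shows "(norm (k x + (\<i> * complex_of_real t) *\<^sub>C x))\<^sup>2 \<le> (norm (k x))\<^sup>2 + t\<^sup>2 * (norm x)\<^sup>2"
proof -
  have "ip (k x + (\<i> * complex_of_real t) *\<^sub>C x) (k x + (\<i> * complex_of_real t) *\<^sub>C x)
      = ip (k x) (k x) + complex_of_real (t\<^sup>2) *\<^sub>C ip x x"
    using symmD[OF assms, of x x]
    by (simp add: ip_simps scaleC_add_right scaleC_diff_right scaleC_scaleC scaleC_minus_left
        power2_eq_square algebra_simps)
  then have "norm (ip (k x + (\<i> * complex_of_real t) *\<^sub>C x) (k x + (\<i> * complex_of_real t) *\<^sub>C x))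
     \<le> norm (ip (k x) (k x)) + norm (complex_of_real (t\<^sup>2) *\<^sub>C ip x x)"
    using norm_triangle_ineq by metis
  then show ?thesis by (simp add: norm_ip_self norm_scaleC norm_power)
qed

lemma norm_symm_diff_nonreal_ge:
  assumes k: "symm k" "\<And>x. norm (k x) \<le> 2 * norm x" and b: "b \<noteq> 0"
  shows "\<bar>b\<bar> / 2 * norm x \<le> norm (k x - (\<i> * complex_of_real b) *\<^sub>C x)"
proof -
  \<comment> \<open>With \<open>\<parallel>k\<parallel> \<le> 2\<close>, this \<open>t\<close> gives \<open>\<surd>(4 + t\<^sup>2) \<le> \<bar>t\<bar> + \<bar>b\<bar> / 4\<close>.\<close>
  define t where "t = 8 / b"
  define u where "u = k x + (\<i> * complex_of_real t) *\<^sub>C x"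
  have abs_bt: "\<bar>b + t\<bar> = \<bar>b\<bar> + 8 / \<bar>b\<bar>" 
  proof (cases "b > 0")
    case False
    then have "b + 8 / b < 0" using b by (intro add_neg_neg divide_pos_neg) auto
    then show ?thesis using False b by (simp add: t_def)
  qed (simp add: t_def)
  have "(norm u)\<^sup>2 \<le> (norm (k x))\<^sup>2 + t\<^sup>2 * (norm x)\<^sup>2"
    unfolding u_def by (rule norm_symm_add_imaginary[OF k(1)])
  also have "\<dots> \<le> (2 * norm x)\<^sup>2 + t\<^sup>2 * (norm x)\<^sup>2"
    by (intro add_mono power_mono k) simp_all
  also have "\<dots> \<le> ((8 / \<bar>b\<bar> + \<bar>b\<bar> / 4) * norm x)\<^sup>2"
  proof -
    have "(8 / \<bar>b\<bar> + \<bar>b\<bar> / 4)\<^sup>2 = t\<^sup>2 + 4 + b\<^sup>2 / 16"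
      using b by (simp add: t_def power2_sum power_divide)
    then have "4 + t\<^sup>2 \<le> (8 / \<bar>b\<bar> + \<bar>b\<bar> / 4)\<^sup>2" by simp
    from mult_right_mono[OF this, of "(norm x)\<^sup>2"]
    show ?thesis unfolding power_mult_distrib[of _ "norm x"] by (simp add: distrib_right)
  qed
  finally have "norm u \<le> (8 / \<bar>b\<bar> + \<bar>b\<bar> / 4) * norm x" by (rule power2_le_imp_le) simp
  moreover have "k x - (\<i> * complex_of_real b) *\<^sub>C x = u - (\<i> * complex_of_real (b + t)) *\<^sub>C x"
    by (simp add: u_def ring_distribs scaleC_add_left)
  moreover have "norm ((\<i> * complex_of_real (b + t)) *\<^sub>C x) = (\<bar>b\<bar> + 8 / \<bar>b\<bar>) * norm x"
    unfolding norm_scaleC_vec norm_mult norm_of_real abs_bt by simp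
  moreover have "norm v - norm u \<le> norm (u - v)" for v
    by (metis norm_minus_commute norm_triangle_ineq2)
  ultimately have "norm (k x - (\<i> * complex_of_real b) *\<^sub>C x) \<ge>
      (\<bar>b\<bar> + 8 / \<bar>b\<bar>) * norm x - (8 / \<bar>b\<bar> + \<bar>b\<bar> / 4) * norm x"
    by (smt (verit))
  moreover have "(\<bar>b\<bar> + 8 / \<bar>b\<bar>) * norm x - (8 / \<bar>b\<bar> + \<bar>b\<bar> / 4) * norm x = \<bar>b\<bar> * norm x * (3 / 4)"
    by (simp add: algebra_simps)
  moreover have "\<bar>b\<bar> / 2 * norm x \<le> \<bar>b\<bar> * norm x * (3 / 4)" by simp
  ultimately show ?thesis by linarith
qed

lemma bij_nonreal_diff:
  assumes h: "symm h" and z: "Im z \<noteq> 0"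
  shows "bij (\<lambda>x. z *\<^sub>C x - h x)"
proof -
  define k where "k x = h x - Re z *\<^sub>R x" for x
  have k: "symm k" unfolding k_def by (intro symm_diff h symm_scaleR_id)
  obtain r where r: "r > 0" "\<And>x. norm (k x) \<le> r * norm x" using symm_bound_ex[OF k] by blast
  define b where "b = Im z"
  \<comment> \<open>Chosen so that \<open>(b + t)\<^sup>2 = b\<^sup>2 + 2 r\<^sup>2 + t\<^sup>2\<close> exceeds \<open>r\<^sup>2 + t\<^sup>2\<close>.\<close>
  define t where "t = r\<^sup>2 / b"
  define W where "W x = k x + (\<i> * complex_of_real t) *\<^sub>C x" for x
  have bl: "bounded_linear W"
  proof -
    have "bounded_linear (\<lambda>x::'x. (\<i> * complex_of_real t) *\<^sub>C x)"
      by (rule bounded_linear_intro[where K = "\<bar>t\<bar>"])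
        (simp_all add: scaleC_add_right scaleR_scaleC scaleC_scaleC norm_scaleC_vec norm_mult mult.commute)
    then show ?thesis unfolding W_def by (intro bounded_linear_add symm_bounded_linear[OF k])
  qed
  have W_le: "norm (W x) \<le> sqrt (r\<^sup>2 + t\<^sup>2) * norm x" for x
  proof (rule power2_le_imp_le)
    have "(norm (W x))\<^sup>2 \<le> (norm (k x))\<^sup>2 + t\<^sup>2 * (norm x)\<^sup>2"
      unfolding W_def by (rule norm_symm_add_imaginary[OF k])
    also have "\<dots> \<le> (r * norm x)\<^sup>2 + t\<^sup>2 * (norm x)\<^sup>2"
      by (intro add_mono power_mono r) simp_all
    finally show "(norm (W x))\<^sup>2 \<le> (sqrt (r\<^sup>2 + t\<^sup>2) * norm x)\<^sup>2"
      by (simp add: power_mult_distrib algebra_simps)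
  qed simp
  have lt: "sqrt (r\<^sup>2 + t\<^sup>2) < cmod (\<i> * complex_of_real (b + t))"
  proof -
    have "b * t = r\<^sup>2" "b\<^sup>2 > 0" using z by (simp_all add: t_def b_def)
    moreover have "r\<^sup>2 > 0" using r by simp
    moreover have "(b + t)\<^sup>2 = b\<^sup>2 + 2 * (b * t) + t\<^sup>2" by (simp add: power2_sum)
    ultimately have "r\<^sup>2 + t\<^sup>2 < (b + t)\<^sup>2" by linarith
    then have "sqrt (r\<^sup>2 + t\<^sup>2) < \<bar>b + t\<bar>" using real_sqrt_less_mono[of _ "(b + t)\<^sup>2"] by simp
    then show ?thesis unfolding norm_mult norm_of_real by simp
  qed
  have "z = complex_of_real (Re z) + \<i> * complex_of_real b"
    by (simp add: b_def complex_eq)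
  then have "z *\<^sub>C x = complex_of_real (Re z) *\<^sub>C x + (\<i> * complex_of_real b) *\<^sub>C x" for x :: 'x
    using scaleC_add_left[of "complex_of_real (Re z)" "\<i> * complex_of_real b" x] by simp
  then have "(\<lambda>x. z *\<^sub>C x - h x) = (\<lambda>x. (\<i> * complex_of_real (b + t)) *\<^sub>C x - W x)"
    by (simp add: W_def k_def fun_eq_iff ring_distribs scaleC_add_left scaleR_scaleC)
  with bij_scaleC_diff[OF bl _ W_le lt] show ?thesis by simp
qed

section \<open>The norm of a symmetric operator is a spectral value\<close>

text \<open>Near \<open>1\<close> and \<open>-1\<close> the operator \<open>1 - z g\<close> is a small perturbation of \<open>1 - g\<close> or \<open>1 + g\<close>.
Elsewhere on the circle \<open>z\<close> is far from the real axis, and \<open>1 - z g = -z (g - cnj z)\<close> is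
bounded below because \<open>cnj z\<close> is not real.\<close>

lemma symm_contraction_bounded_below_on_circle:
  assumes g: "symm g" "\<And>x. norm (g x) \<le> norm x"
    and e: "e > 0" "\<And>x. e * norm x \<le> norm (x - g x)" "\<And>x. e * norm x \<le> norm (x + g x)"
  obtains c where "c > 0" "\<And>z x. cmod z = 1 \<Longrightarrow> c * norm x \<le> norm (x - z *\<^sub>C g x)"
proof
  show "min (e / 2) (e\<^sup>2 / 16) > 0" using e by simp
  fix z :: complex and x
  assume z: "cmod z = 1"
  have gle: "cmod w * norm (g x) \<le> cmod w * norm x" for w
    by (intro mult_left_mono g) simp
  consider "cmod (1 - z) \<le> e / 2" | "cmod (1 + z) \<le> e / 2"
    | "cmod (1 - z) > e / 2" "cmod (1 + z) > e / 2" by linarith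
  then have "e / 2 * norm x \<le> norm (x - z *\<^sub>C g x) \<or> e\<^sup>2 / 16 * norm x \<le> norm (x - z *\<^sub>C g x)"
  proof cases
    case 1
    have "x - g x = (x - z *\<^sub>C g x) - (1 - z) *\<^sub>C g x"
      by (simp add: scaleC_diff_left scaleC_one)
    then have "norm (x - g x) \<le> norm (x - z *\<^sub>C g x) + cmod (1 - z) * norm (g x)"
      by (metis norm_triangle_ineq4 norm_scaleC_vec)
    then show ?thesis using e(2)[of x] gle[of "1 - z"] mult_right_mono[OF 1, of "norm x"] by simp
  next
    case 2
    have "x + g x = (x - z *\<^sub>C g x) + (1 + z) *\<^sub>C g x"
      by (simp add: scaleC_add_left scaleC_one)
    then have "norm (x + g x) \<le> norm (x - z *\<^sub>C g x) + cmod (1 + z) * norm (g x)"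
      by (metis norm_triangle_ineq norm_scaleC_vec)
    then show ?thesis using e(3)[of x] gle[of "1 + z"] mult_right_mono[OF 2, of "norm x"] by simp
  next
    case 3
    have zz: "z * cnj z = 1" using complex_norm_square[of z] z by simp
    \<comment> \<open>On the circle, the distances to \<open>1\<close> and \<open>-1\<close> control the distance to the real axis.\<close>
    have "(1 - z) * (1 + z) = z * (cnj z - z)" using zz by (simp add: algebra_simps)
    then have "cmod (1 - z) * cmod (1 + z) = cmod (cnj z - z)"
      using z by (simp flip: norm_mult) (simp add: norm_mult)
    also have "cnj z - z = - 2 * \<i> * complex_of_real (Im z)" by (simp add: complex_eq_iff)
    finally have im: "cmod (1 - z) * cmod (1 + z) = 2 * \<bar>Im z\<bar>" by (simp add: norm_mult)
    have "e / 2 * (e / 2) \<le> cmod (1 - z) * cmod (1 + z)" using 3 e by (intro mult_mono) auto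
    then have im_ge: "e\<^sup>2 / 8 \<le> \<bar>Im z\<bar>" unfolding im by (simp add: power2_eq_square)
    define k where "k x = g x - Re z *\<^sub>R x" for x
    have k: "symm k" unfolding k_def by (intro symm_diff g symm_scaleR_id)
    have k2: "norm (k y) \<le> 2 * norm y" for y
    proof -
      have "norm (k y) \<le> norm (g y) + \<bar>Re z\<bar> * norm y"
        unfolding k_def using norm_triangle_ineq4[of "g y" "Re z *\<^sub>R y"] by simp
      moreover have "\<bar>Re z\<bar> * norm y \<le> 1 * norm y"
        using abs_Re_le_cmod[of z] z by (intro mult_right_mono) auto
      ultimately show ?thesis using g(2)[of y] by simp
    qed
    have "cnj z = complex_of_real (Re z) + \<i> * complex_of_real (- Im z)"
      by (simp add: complex_eq_iff)
    then have "cnj z *\<^sub>C x = Re z *\<^sub>R x + (\<i> * complex_of_real (- Im z)) *\<^sub>C x"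
      using scaleC_add_left[of "complex_of_real (Re z)" "\<i> * complex_of_real (- Im z)" x]
      by (simp add: scaleR_scaleC)
    then have "k x - (\<i> * complex_of_real (- Im z)) *\<^sub>C x = g x - cnj z *\<^sub>C x"
      by (simp add: k_def)
    moreover have "x - z *\<^sub>C g x = - (z *\<^sub>C (g x - cnj z *\<^sub>C x))"
      by (simp add: scaleC_diff_right scaleC_scaleC zz scaleC_one)
    ultimately have "x - z *\<^sub>C g x = - (z *\<^sub>C (k x - (\<i> * complex_of_real (- Im z)) *\<^sub>C x))"
      by simp
    then have "norm (x - z *\<^sub>C g x) = norm (k x - (\<i> * complex_of_real (- Im z)) *\<^sub>C x)"
      using z by (simp only: norm_minus_cancel norm_scaleC_vec mult_1)
    moreover have "\<bar>- Im z\<bar> / 2 * norm x \<le> norm (k x - (\<i> * complex_of_real (- Im z)) *\<^sub>C x)"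
      using im_ge e by (intro norm_symm_diff_nonreal_ge k k2) auto
    moreover have "e\<^sup>2 / 16 * norm x \<le> \<bar>- Im z\<bar> / 2 * norm x"
      using im_ge by (intro mult_right_mono) auto
    ultimately show ?thesis by linarith
  qed
  then show "min (e / 2) (e\<^sup>2 / 16) * norm x \<le> norm (x - z *\<^sub>C g x)"
    by (meson min.cobounded1 min.cobounded2 mult_right_mono norm_ge_zero order_trans)
qed

text \<open>For a \<open>2 m\<close>-th root of unity \<open>z\<close>, the geometric sum \<open>S z = \<Sum>j<2m. z\<^sup>j g\<^sup>j x\<close> solves
\<open>(1 - z g) (S z) = y\<close> with the same right-hand side \<open>y = x - g\<^sup>2\<^sup>m x\<close> for all \<open>z\<close>. By the
resolvent identity \<open>S\<close> varies by at most \<open>\<bar>1 - w\<bar> \<parallel>y\<parallel> / c\<^sup>2\<close> between neighbouring roots,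
and the alternating sum of the values of \<open>S\<close> is \<open>2 m g\<^sup>m x\<close>. Since \<open>w = exp (i \<pi> / m)\<close>
tends to 1, the bound tends to 0 as \<open>m\<close> grows.\<close>

lemma norm_funpow_le_of_bounded_below:
  assumes g: "symm g" "\<And>x. norm (g x) \<le> norm x"
    and c: "c > 0" "\<And>z x. cmod z = 1 \<Longrightarrow> c * norm x \<le> norm (x - z *\<^sub>C g x)"
    and m: "m > 0"
  shows "norm ((g ^^ m) x) \<le> cmod (1 - cis (pi / m)) / c\<^sup>2 * norm x"
proof -
  define w where "w = cis (pi / m)"
  define S where "S z = (\<Sum>j<2*m. z ^ j *\<^sub>C (g ^^ j) x)" for z :: complex
  define y where "y = x - (g ^^ (2 * m)) x"
  have pow_le: "norm ((g ^^ n) v) \<le> norm v" for n v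
    by (induction n) (auto intro: order_trans[OF g(2)])
  have w2m: "w ^ (2 * m) = 1" using m by (simp add: w_def Complex.DeMoivre)
  have S: "S z - z *\<^sub>C g (S z) = y" if "z ^ (2 * m) = 1" for z
  proof -
    have "z *\<^sub>C g (S z) = (\<Sum>j<2*m. z ^ Suc j *\<^sub>C (g ^^ Suc j) x)"
      by (simp add: S_def symm_maps_sum[OF g(1)] symm_maps_scaleC[OF g(1)] scaleC_sum_right scaleC_scaleC)
    then have "S z - z *\<^sub>C g (S z) = (\<Sum>j<2*m. z ^ j *\<^sub>C (g ^^ j) x - z ^ Suc j *\<^sub>C (g ^^ Suc j) x)"
      by (simp add: S_def sum_subtractf)
    also have "\<dots> = z ^ 0 *\<^sub>C (g ^^ 0) x - z ^ (2 * m) *\<^sub>C (g ^^ (2 * m)) x"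
      by (rule sum_lessThan_telescope')
    finally show ?thesis using that by (simp add: y_def scaleC_one)
  qed
  have root: "(w ^ k) ^ (2 * m) = 1" for k
  proof -
    have "(w ^ k) ^ (2 * m) = (w ^ (2 * m)) ^ k" by (simp add: mult_ac flip: power_mult)
    then show ?thesis by (simp only: w2m power_one)
  qed
  have unit: "cmod (w ^ k) = 1" for k by (simp add: w_def norm_power)
  have y_le: "norm y \<le> 2 * norm x"
    using norm_triangle_ineq4[of x "(g ^^ (2 * m)) x"] pow_le[of "2 * m" x] by (simp add: y_def)
  have diff: "norm (S (w ^ k) - S (w ^ Suc k)) \<le> cmod (1 - w) / c\<^sup>2 * norm y" for k
  proof -
    let ?d = "S (w ^ k) - S (w ^ Suc k)"
    have "?d - w ^ k *\<^sub>C g ?d = (S (w ^ k) - w ^ k *\<^sub>C g (S (w ^ k)))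
        - (S (w ^ Suc k) - w ^ Suc k *\<^sub>C g (S (w ^ Suc k))) + (w ^ k - w ^ Suc k) *\<^sub>C g (S (w ^ Suc k))"
      by (simp add: symm_maps_diff[OF g(1)] scaleC_diff_right scaleC_diff_left)
    also have "\<dots> = (w ^ k - w ^ Suc k) *\<^sub>C g (S (w ^ Suc k))"
      unfolding S[OF root] by simp
    also have "norm \<dots> = cmod (1 - w) * norm (g (S (w ^ Suc k)))"
    proof -
      have "w ^ k - w ^ Suc k = w ^ k * (1 - w)" by (simp add: algebra_simps)
      then show ?thesis by (simp only: norm_scaleC_vec norm_mult unit mult_1)
    qed
    also have "\<dots> \<le> cmod (1 - w) * norm (S (w ^ Suc k))" by (intro mult_left_mono g) simp
    finally have 1: "c * norm ?d \<le> cmod (1 - w) * norm (S (w ^ Suc k))"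
      using c(2)[OF unit[of k], of ?d] by simp
    have 2: "c * norm (S (w ^ Suc k)) \<le> norm y"
      using c(2)[OF unit[of "Suc k"], of "S (w ^ Suc k)"] unfolding S[OF root] .
    have "c * (c * norm ?d) \<le> c * (cmod (1 - w) * norm (S (w ^ Suc k)))"
      using 1 c(1) by (intro mult_left_mono) auto
    also have "\<dots> = cmod (1 - w) * (c * norm (S (w ^ Suc k)))" by simp
    also have "\<dots> \<le> cmod (1 - w) * norm y" using 2 by (intro mult_left_mono) auto
    finally show ?thesis using c(1) by (simp add: field_simps power2_eq_square)
  qed
  have "(\<Sum>k<m. S (w ^ (2 * k)) - S (w ^ (2 * k + 1)))
      = (\<Sum>k<m. \<Sum>j<2*m. (w ^ (2 * k * j) - w ^ ((2 * k + 1) * j)) *\<^sub>C (g ^^ j) x)"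
    unfolding S_def power_mult[symmetric] sum_subtractf[symmetric] scaleC_diff_left ..
  also have "\<dots> = (\<Sum>j<2*m. (\<Sum>k<m. w ^ (2 * k * j) - w ^ ((2 * k + 1) * j)) *\<^sub>C (g ^^ j) x)"
    unfolding scaleC_sum_left by (rule sum.swap)
  also have "\<dots> = (\<Sum>j<2*m. (if j = m then of_nat (2 * m) else 0) *\<^sub>C (g ^^ j) x)"
    unfolding w_def by (intro sum.cong refl) (subst alternating_root_sum, use m in auto)
  also have "\<dots> = (\<Sum>j<2*m. if j = m then of_nat (2 * m) *\<^sub>C (g ^^ m) x else 0)"
    by (intro sum.cong refl) auto
  also have "\<dots> = of_nat (2 * m) *\<^sub>C (g ^^ m) x" using m by simp
  finally have "of_nat (2 * m) *\<^sub>C (g ^^ m) x = (\<Sum>k<m. S (w ^ (2 * k)) - S (w ^ (2 * k + 1)))" ..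
  then have "norm (of_nat (2 * m) *\<^sub>C (g ^^ m) x) \<le> (\<Sum>k<m. norm (S (w ^ (2 * k)) - S (w ^ (2 * k + 1))))"
    by (simp only: norm_sum)
  also have "\<dots> \<le> (\<Sum>k<m. cmod (1 - w) / c\<^sup>2 * (2 * norm x))"
  proof (rule sum_mono)
    fix k
    have "norm (S (w ^ (2 * k)) - S (w ^ (2 * k + 1))) \<le> cmod (1 - w) / c\<^sup>2 * norm y"
      using diff[of "2 * k"] by simp
    also have "\<dots> \<le> cmod (1 - w) / c\<^sup>2 * (2 * norm x)" by (intro mult_left_mono y_le) simp
    finally show "norm (S (w ^ (2 * k)) - S (w ^ (2 * k + 1))) \<le> cmod (1 - w) / c\<^sup>2 * (2 * norm x)" .
  qed
  finally have "2 * m * norm ((g ^^ m) x) \<le> 2 * m * (cmod (1 - w) / c\<^sup>2 * norm x)"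
    unfolding norm_scaleC_vec norm_of_nat by (simp add: mult_ac)
  then have "real (2 * m) * norm ((g ^^ m) x) \<le> real (2 * m) * (cmod (1 - w) / c\<^sup>2 * norm x)"
    by (simp only: of_nat_mult of_nat_numeral)
  then show ?thesis unfolding w_def by (rule mult_left_le_imp_le) (use m in simp)
qed

text \<open>Iterated use of \<open>\<parallel>h x\<parallel>\<^sup>2 = \<parallel>\<langle>x, h\<^sup>2 x\<rangle>\<parallel> \<le> \<parallel>x\<parallel> \<parallel>h\<^sup>2 x\<parallel>\<close> for the powers \<open>h = g, g\<^sup>2, g\<^sup>4, \<dots>\<close>: a symmetric
operator whose powers decay has small norm.\<close>

lemma symm_norm_le_of_funpow:
  assumes g: "symm g" and d: "d \<ge> 0"
    and le: "\<And>x. norm ((g ^^ (2 ^ k)) x) \<le> d ^ (2 ^ k) * norm x"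
  shows "norm (g x) \<le> d * norm x"
  using le
proof (induction k arbitrary: x)
  case (Suc k)
  show ?case
  proof (rule Suc.IH)
    fix x
    have "(norm ((g ^^ 2 ^ k) x))\<^sup>2 = norm (ip ((g ^^ 2 ^ k) x) ((g ^^ 2 ^ k) x))"
      by (rule norm_ip_self[symmetric])
    also have "ip ((g ^^ 2 ^ k) x) ((g ^^ 2 ^ k) x) = ip x ((g ^^ 2 ^ Suc k) x)"
      by (simp add: symmD[OF symm_funpow[OF g]] mult_2 funpow_add)
    also have "norm \<dots> \<le> norm x * (d ^ (2 ^ Suc k) * norm x)"
      by (rule order_trans[OF norm_ip_le mult_left_mono[OF Suc.prems]]) simp
    also have "d ^ (2 ^ Suc k) = d ^ (2 ^ k) * d ^ (2 ^ k)"
      by (simp add: mult_2 flip: power_add)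
    also have "norm x * (d ^ (2 ^ k) * d ^ (2 ^ k) * norm x) = (d ^ (2 ^ k) * norm x)\<^sup>2"
      by (simp add: power2_eq_square)
    finally show "norm ((g ^^ 2 ^ k) x) \<le> d ^ (2 ^ k) * norm x"
      by (rule power2_le_imp_le) (use d in simp)
  qed
qed simp

text \<open>The norm of a symmetric contraction can be 1 only if \<open>1\<close> or \<open>-1\<close> is in its spectrum.
Invertible symmetric operators are bounded below, since their inverses are symmetric and hence
bounded; this bound spreads to the whole unit circle and forces the powers of \<open>g\<close> to decay.\<close>

lemma symm_contraction_norm_less_1:
  assumes g: "symm g" "\<And>x. norm (g x) \<le> norm x"
    and bij: "bij (\<lambda>x. x - g x)" "bij (\<lambda>x. x + g x)"
  obtains d where "d < 1" "\<And>x. norm (g x) \<le> d * norm x"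
proof -
  have id: "symm (\<lambda>x. x)" by (simp add: symm_def)
  obtain c1 where c1: "c1 > 0" "\<And>x. c1 * norm x \<le> norm (x - g x)"
    using symm_bij_bounded_below[OF symm_diff[OF id g(1)] bij(1)] by blast
  obtain c2 where c2: "c2 > 0" "\<And>x. c2 * norm x \<le> norm (x + g x)"
    using symm_bij_bounded_below[OF symm_add[OF id g(1)] bij(2)] by blast
  have le: "min c1 c2 * norm x \<le> c1 * norm x" "min c1 c2 * norm x \<le> c2 * norm x" for x :: 'x
    by (intro mult_right_mono; simp)+
  obtain c where c: "c > 0" "\<And>z x. cmod z = 1 \<Longrightarrow> c * norm x \<le> norm (x - z *\<^sub>C g x)"
  proof (rule symm_contraction_bounded_below_on_circle[OF g, where e = "min c1 c2"])
    show "min c1 c2 > 0" using c1 c2 by simp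
    show "min c1 c2 * norm x \<le> norm (x - g x)" for x by (rule order_trans[OF le(1) c1(2)])
    show "min c1 c2 * norm x \<le> norm (x + g x)" for x by (rule order_trans[OF le(2) c2(2)])
  qed blast
  have "(\<lambda>k. pi / 2 ^ k) \<longlonglongrightarrow> 0" 
    using tendsto_mult_right_zero[OF LIMSEQ_realpow_zero[of "1 / 2"], of pi]
    by (simp add: power_divide)
  then have "(\<lambda>k. cis (pi / 2 ^ k)) \<longlonglongrightarrow> cis 0" by (rule tendsto_cis)
  then have "(\<lambda>k. cmod (1 - cis (pi / 2 ^ k)) / c\<^sup>2) \<longlonglongrightarrow> cmod (1 - cis 0) / c\<^sup>2"
    using c(1) by (intro tendsto_divide tendsto_norm tendsto_diff tendsto_const) simp_all
  then have "eventually (\<lambda>k. cmod (1 - cis (pi / 2 ^ k)) / c\<^sup>2 < 1 / 2) sequentially"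
    by (rule order_tendstoD) simp
  then obtain k where k: "cmod (1 - cis (pi / 2 ^ k)) / c\<^sup>2 < 1 / 2"
    by (auto simp: eventually_sequentially)
  \<comment> \<open>The decay of a single power \<open>g\<^sup>m\<close> with \<open>m = 2\<^sup>k\<close> suffices: its norm is at most \<open>1 / 2\<close>.\<close>
  define d where "d = root (2 ^ k) (1 / 2)"
  have d: "d ^ (2 ^ k) = 1 / 2" "d \<ge> 0" "d < 1" by (simp_all add: d_def)
  have "norm (g x) \<le> d * norm x" for x
  proof (rule symm_norm_le_of_funpow[OF g(1) d(2), where k = k])
    fix x
    have "norm ((g ^^ 2 ^ k) x) \<le> cmod (1 - cis (pi / 2 ^ k)) / c\<^sup>2 * norm x"
      using norm_funpow_le_of_bounded_below[OF g c, of "2 ^ k"] by simp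
    also have "\<dots> \<le> d ^ 2 ^ k * norm x"
      unfolding d using k by (intro mult_right_mono) auto
    finally show "norm ((g ^^ 2 ^ k) x) \<le> d ^ 2 ^ k * norm x" .
  qed
  then show ?thesis using that d by blast
qed

section \<open>Positive symmetric operators\<close>

text \<open>Positivity of a symmetric operator: its spectrum contains no negative real number, and non-real
numbers are excluded by \<open>bij_nonreal_diff\<close>.\<close>

definition posop :: "('x \<Rightarrow> 'x) \<Rightarrow> bool" where
  "posop h \<longleftrightarrow> symm h \<and> (\<forall>s>0. bij (\<lambda>x. h x + s *\<^sub>R x))"

lemma posop_symm: "posop h \<Longrightarrow> symm h"
  by (simp add: posop_def)

lemma posop_bij: "posop h \<Longrightarrow> s > 0 \<Longrightarrow> bij (\<lambda>x. h x + s *\<^sub>R x)"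
  by (simp add: posop_def)

lemma posop_of_norm_diff_le:
  assumes h: "symm h" and r: "0 \<le> r" "\<And>x. norm (r *\<^sub>R x - h x) \<le> r * norm x"
  shows "posop h"
  unfolding posop_def
proof (intro conjI allI impI h)
  fix s :: real assume s: "s > 0"
  have "bij (\<lambda>x. (r + s) *\<^sub>R x - (r *\<^sub>R x - h x))"
    by (rule bij_scaleR_diff[OF symm_bounded_linear[OF symm_diff[OF symm_scaleR_id h]] r])
      (use s in simp)
  then show "bij (\<lambda>x. h x + s *\<^sub>R x)" by (simp add: algebra_simps)
qed

lemma posop_scaleR_id: "0 \<le> r \<Longrightarrow> posop (\<lambda>x. r *\<^sub>R x)"
  by (rule posop_of_norm_diff_le[where r = r]) (simp_all add: symm_scaleR_id)

lemma bij_scaleR: "c \<noteq> 0 \<Longrightarrow> bij (\<lambda>x::'x. c *\<^sub>R x)"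
  by (rule o_bij[where g = "\<lambda>x. inverse c *\<^sub>R x"]) (simp_all add: fun_eq_iff)

text \<open>If the norm \<open>N\<close> of \<open>h\<close> exceeded \<open>r\<close>, then \<open>h / N\<close> would be a contraction to which
\<open>symm_contraction_norm_less_1\<close> applies, and the norm of \<open>h\<close> would be less than \<open>N\<close>.\<close>

lemma norm_symm_le_of_bij:
  assumes h: "symm h" and r: "0 \<le> r"
    and minus: "\<And>s. s > r \<Longrightarrow> bij (\<lambda>x. s *\<^sub>R x - h x)"
    and plus: "\<And>s. s > r \<Longrightarrow> bij (\<lambda>x. s *\<^sub>R x + h x)"
  shows "norm (h x) \<le> r * norm x"
proof -
  have bl: "bounded_linear h" by (rule symm_bounded_linear[OF h])
  define N where "N = onorm h"
  have "N \<le> r"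
  proof (rule ccontr)
    assume "\<not> N \<le> r"
    with r have N: "N > r" "N > 0" by auto
    define g where "g x = (1 / N) *\<^sub>R h x" for x
    have g: "symm g" unfolding g_def by (rule symm_scaleR[OF h])
    have g_le: "norm (g x) \<le> norm x" for x
      using onorm[OF bl, of x] N by (simp add: g_def N_def[symmetric] field_simps)
    have "(\<lambda>x. x - g x) = (\<lambda>x. (1 / N) *\<^sub>R x) \<circ> (\<lambda>x. N *\<^sub>R x - h x)"
      using N by (simp add: g_def fun_eq_iff scaleR_diff_right)
    then have bij1: "bij (\<lambda>x. x - g x)"
      using bij_comp[OF minus[OF N(1)] bij_scaleR[of "1 / N"]] N by simp
    have "(\<lambda>x. x + g x) = (\<lambda>x. (1 / N) *\<^sub>R x) \<circ> (\<lambda>x. N *\<^sub>R x + h x)"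
      using N by (simp add: g_def fun_eq_iff scaleR_add_right)
    then have bij2: "bij (\<lambda>x. x + g x)"
      using bij_comp[OF plus[OF N(1)] bij_scaleR[of "1 / N"]] N by simp
    obtain d where d: "d < 1" "\<And>x. norm (g x) \<le> d * norm x"
      using symm_contraction_norm_less_1[OF g g_le bij1 bij2] by blast
    \<comment> \<open>The maximum covers the trivial space, where \<open>d\<close> may be negative.\<close>
    have "onorm h \<le> max (N * d) 0"
    proof (rule onorm_bound)
      fix x
      have "norm (h x) = N * norm (g x)" using N by (simp add: g_def)
      also have "\<dots> \<le> N * d * norm x" using d(2)[of x] N by simp
      also have "\<dots> \<le> max (N * d) 0 * norm x" by (intro mult_right_mono) auto
      finally show "norm (h x) \<le> max (N * d) 0 * norm x" .
    qed simp
    moreover have "N * d < N" using d(1) N mult_strict_left_mono[of d 1 N] by simp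
    ultimately show False using N(2) unfolding N_def[symmetric] by linarith
  qed
  then show ?thesis
    using onorm[OF bl, of x] mult_right_mono[of N r "norm x"] by (simp add: N_def)
qed

text \<open>The spectrum of \<open>h\<close> lies in \<open>[0, r]\<close>, hence so does that of \<open>r - h\<close>, whose norm is
therefore at most \<open>r\<close>. Conversely, \<open>posop_of_norm_diff_le\<close> obtains positivity from such an
inequality, so positivity is a condition that the triangle inequality can handle.\<close>

lemma posop_norm_diff_le:
  assumes h: "posop h" and r: "0 \<le> r" "\<And>x. norm (h x) \<le> r * norm x"
  shows "norm (r *\<^sub>R x - h x) \<le> r * norm x"
proof (rule norm_symm_le_of_bij[OF _ r(1)])
  show "symm (\<lambda>x. r *\<^sub>R x - h x)" by (intro symm_diff symm_scaleR_id posop_symm h)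
next
  fix s assume s: "s > r"
  show "bij (\<lambda>x. s *\<^sub>R x - (r *\<^sub>R x - h x))"
    using posop_bij[OF h, of "s - r"] s by (simp add: algebra_simps)
  show "bij (\<lambda>x. s *\<^sub>R x + (r *\<^sub>R x - h x))"
    using bij_scaleR_diff[OF symm_bounded_linear[OF posop_symm[OF h]] r, of "s + r"] s r
    by (simp add: algebra_simps)
qed

text \<open>The inequalities \<open>\<parallel>r\<^sub>1 - h\<parallel> \<le> r\<^sub>1\<close> and \<open>\<parallel>r\<^sub>2 - k\<parallel> \<le> r\<^sub>2\<close> add up to one of the same kind.\<close>

lemma posop_add:
  assumes h: "posop h" and k: "posop k"
  shows "posop (\<lambda>x. h x + k x)"
proof -
  obtain r1 where r1: "r1 > 0" "\<And>x. norm (h x) \<le> r1 * norm x"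
    using symm_bound_ex[OF posop_symm[OF h]] by blast
  obtain r2 where r2: "r2 > 0" "\<And>x. norm (k x) \<le> r2 * norm x"
    using symm_bound_ex[OF posop_symm[OF k]] by blast
  show ?thesis
  proof (rule posop_of_norm_diff_le)
    show "symm (\<lambda>x. h x + k x)" by (intro symm_add posop_symm h k)
    show "0 \<le> r1 + r2" using r1 r2 by simp
    fix x
    have "(r1 + r2) *\<^sub>R x - (h x + k x) = (r1 *\<^sub>R x - h x) + (r2 *\<^sub>R x - k x)"
      by (simp add: algebra_simps)
    also have "norm \<dots> \<le> r1 * norm x + r2 * norm x"
      using r1 r2 by (intro norm_triangle_mono posop_norm_diff_le h k) auto
    finally show "norm ((r1 + r2) *\<^sub>R x - (h x + k x)) \<le> (r1 + r2) * norm x"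
      by (simp add: algebra_simps)
  qed
qed

lemma posop_scaleR:
  assumes h: "posop h" and c: "0 \<le> c"
  shows "posop (\<lambda>x. c *\<^sub>R h x)"
proof -
  obtain r where r: "r > 0" "\<And>x. norm (h x) \<le> r * norm x"
    using symm_bound_ex[OF posop_symm[OF h]] by blast
  show ?thesis
  proof (rule posop_of_norm_diff_le)
    fix x
    have "(c * r) *\<^sub>R x - c *\<^sub>R h x = c *\<^sub>R (r *\<^sub>R x - h x)" by (simp add: scaleR_diff_right)
    then have "norm ((c * r) *\<^sub>R x - c *\<^sub>R h x) = c * norm (r *\<^sub>R x - h x)" using c by simp
    also have "\<dots> \<le> c * (r * norm x)"
      using r c by (intro mult_left_mono posop_norm_diff_le h) auto
    finally show "norm ((c * r) *\<^sub>R x - c *\<^sub>R h x) \<le> c * r * norm x" by simp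
  qed (use r c in \<open>auto intro: symm_scaleR posop_symm h\<close>)
qed

lemma posop_of_posop_add_scaleR:
  assumes h: "symm h" and e: "\<And>e. e > 0 \<Longrightarrow> posop (\<lambda>x. h x + e *\<^sub>R x)"
  shows "posop h"
  unfolding posop_def
proof (intro conjI allI impI h)
  fix s :: real assume "s > 0"
  then have "bij (\<lambda>x. h x + (s / 2) *\<^sub>R x + (s / 2) *\<^sub>R x)"
    using posop_bij[OF e, of "s / 2" "s / 2"] by simp
  then show "bij (\<lambda>x. h x + s *\<^sub>R x)" by (simp add: add.assoc flip: scaleR_add_left)
qed

text \<open>The order interval \<open>-r \<le> h \<le> r\<close> is contained in the ball of radius \<open>r\<close>.\<close>

lemma norm_symm_le_of_posop:
  assumes h: "symm h" and r: "0 \<le> r"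
    and pos: "posop (\<lambda>x. r *\<^sub>R x - h x)" "posop (\<lambda>x. r *\<^sub>R x + h x)"
  shows "norm (h x) \<le> r * norm x"
proof (rule norm_symm_le_of_bij[OF h r])
  fix s assume "s > r"
  then show "bij (\<lambda>x. s *\<^sub>R x - h x)" "bij (\<lambda>x. s *\<^sub>R x + h x)"
    using posop_bij[OF pos(1), of "s - r"] posop_bij[OF pos(2), of "s - r"]
    by (simp_all add: algebra_simps)
qed

text \<open>Monotonicity of the norm: if \<open>h + k \<le> r\<close> then \<open>r - h = (r - (h + k)) + k\<close> is positive, and so
is \<open>r + h\<close>.\<close>

lemma posop_norm_le_of_add:
  assumes h: "posop h" and k: "posop k"
    and r: "0 \<le> r" "\<And>x. norm (h x + k x) \<le> r * norm x"
  shows "norm (h x) \<le> r * norm x"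
proof (rule norm_symm_le_of_posop[OF posop_symm[OF h] r(1)])
  have "posop (\<lambda>x. r *\<^sub>R x - (h x + k x))"
  proof (rule posop_of_norm_diff_le[OF _ r(1)])
    show "symm (\<lambda>x. r *\<^sub>R x - (h x + k x))"
      by (intro symm_diff symm_add symm_scaleR_id posop_symm h k)
    show "norm (r *\<^sub>R x - (r *\<^sub>R x - (h x + k x))) \<le> r * norm x" for x
      using r(2)[of x] by (simp add: add.commute)
  qed
  from posop_add[OF this k] show "posop (\<lambda>x. r *\<^sub>R x - h x)" by simp
  show "posop (\<lambda>x. r *\<^sub>R x + h x)" by (intro posop_add posop_scaleR_id h r(1))
qed

end

section \<open>Positive elements of the algebra\<close>

interpretation alg: cstar_form "\<lambda>a b::'a::cstar_algebra. star a * b"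
proof
  fix x y z :: 'a and c
  show "star x * (y + z) = star x * y + star x * z" by (rule distrib_left)
  show "star x * (c *\<^sub>C y) = c *\<^sub>C (star x * y)" by (rule mult_scaleC_right)
  show "star (star x * y) = star y * x" by (simp add: star_mult star_star)
  show "norm (star x * x) = (norm x)\<^sup>2" by (rule cstar_identity)
  show "norm (star x * y) \<le> norm x * norm y" using norm_mult_ineq[of "star x" y] by simp
qed

text \<open>Positivity through the left regular representation. Passing to operators avoids a norm on the
unitization.\<close>

definition pos_elem :: "'a::cstar_algebra \<Rightarrow> bool" where
  "pos_elem a \<longleftrightarrow> alg.posop ((*) a)"

lemma symm_mult_left: "star a = a \<Longrightarrow> alg.symm ((*) a)"
  by (simp add: alg.symm_def star_mult mult.assoc)

text \<open>The left regular representation is isometric: test it on \<open>x = a\<^sup>*\<close> and use the C*-identity.\<close>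

lemma norm_le_of_mult_left:
  fixes a :: "'a::cstar_algebra"
  assumes "0 \<le> r" "\<And>x. norm (a * x) \<le> r * norm x"
  shows "norm a \<le> r"
proof (cases "a = 0")
  case False
  have "norm a * norm a \<le> r * norm a"
    using assms(2)[of "star a"] cstar_identity[of "star a"]
    by (simp add: star_star power2_eq_square)
  then show ?thesis using False by simp
next
  case True
  then show ?thesis using assms(1) by simp
qed

text \<open>An inverse \<open>(b, w)\<close> of \<open>a + s\<close> in the unitization acts on the algebra as
\<open>x \<mapsto> b x + w x\<close>, and this map inverts \<open>x \<mapsto> a x + s x\<close>.\<close>

lemma cstar_positive_imp_pos_elem:
  fixes a :: "'a::cstar_algebra"
  assumes "cstar_positive a" shows "pos_elem a"
  unfolding pos_elem_def alg.posop_def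
proof (intro conjI allI impI)
  show "alg.symm ((*) a)" using assms by (simp add: cstar_positive_def symm_mult_left)
  fix s :: real assume s: "s > 0"
  have "complex_of_real (- s) \<notin> \<real>\<^sub>\<ge>\<^sub>0" using s by (simp only: nonneg_Reals_of_real_iff)
  then have "complex_of_real (- s) \<notin> cstar_spectrum a"
    using assms unfolding cstar_positive_def by blast
  then obtain b w where bw: "unitization_mult (b, w) (a, complex_of_real s) = (0, 1)"
      "unitization_mult (a, complex_of_real s) (b, w) = (0, 1)"
    unfolding cstar_spectrum_def by auto
  let ?s = "complex_of_real s"
  have e: "b * a + w *\<^sub>C a + ?s *\<^sub>C b = 0" "a * b + ?s *\<^sub>C b + w *\<^sub>C a = 0" "w * ?s = 1"
    using bw by (simp_all add: unitization_mult_def)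
  show "bij (\<lambda>x. a * x + s *\<^sub>R x)"
  proof (rule o_bij[where g = "\<lambda>x. b * x + w *\<^sub>C x"])
    show "(\<lambda>x. b * x + w *\<^sub>C x) \<circ> (\<lambda>x. a * x + s *\<^sub>R x) = id"
    proof
      fix x
      have "b * (a * x + s *\<^sub>R x) + w *\<^sub>C (a * x + s *\<^sub>R x)
          = (b * a + w *\<^sub>C a + ?s *\<^sub>C b) * x + (w * ?s) *\<^sub>C x"
        by (simp add: scaleR_scaleC distrib_left distrib_right mult.assoc mult_scaleC_left
            mult_scaleC_right scaleC_add_right scaleC_scaleC)
      then show "((\<lambda>x. b * x + w *\<^sub>C x) \<circ> (\<lambda>x. a * x + s *\<^sub>R x)) x = id x"
        by (simp add: e scaleC_one)
    qed
    show "(\<lambda>x. a * x + s *\<^sub>R x) \<circ> (\<lambda>x. b * x + w *\<^sub>C x) = id"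
    proof
      fix x
      have "a * (b * x + w *\<^sub>C x) + s *\<^sub>R (b * x + w *\<^sub>C x)
          = (a * b + ?s *\<^sub>C b + w *\<^sub>C a) * x + (w * ?s) *\<^sub>C x"
        by (simp add: scaleR_scaleC distrib_left distrib_right mult.assoc mult_scaleC_left
            mult_scaleC_right scaleC_add_right scaleC_scaleC mult.commute[of w])
      then show "((\<lambda>x. a * x + s *\<^sub>R x) \<circ> (\<lambda>x. b * x + w *\<^sub>C x)) x = id x"
        by (simp add: e scaleC_one)
    qed
  qed
qed

lemma pos_elem_scaleR: "pos_elem a \<Longrightarrow> 0 \<le> r \<Longrightarrow> pos_elem (r *\<^sub>R a)"
  using alg.posop_scaleR[of "(*) a" r] by (simp add: pos_elem_def mult_scaleR_left[abs_def])

lemma pos_elem_norm_le_add: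
  assumes "pos_elem a" "pos_elem b" shows "norm a \<le> norm (a + b)"
proof (rule norm_le_of_mult_left)
  fix x
  show "norm (a * x) \<le> norm (a + b) * norm x"
    by (rule alg.posop_norm_le_of_add[where k = "(*) b"])
      (use assms in \<open>simp_all add: pos_elem_def norm_mult_ineq flip: distrib_right\<close>)
qed simp

section \<open>Hilbert modules\<close>

context hilbert_module begin

lemma ip_act_left: "ip (act x a) y = star a * ip x y"
  using arg_cong[OF ip_act_right[of y x a], of star] by (simp add: star_mult star_ip)

lemma norm_ip_self_eq: "norm (ip x x) = (norm x)\<^sup>2"
  by (simp add: norm_eq_sqrt_ip)

lemma norm_act_le: "norm (act x a) \<le> norm x * norm a"
proof (rule power2_le_imp_le)
  have "norm (star a * (ip x x * a)) \<le> norm a * (norm (ip x x) * norm a)"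
    by (rule order_trans[OF norm_mult_ineq]) (simp add: mult_left_mono norm_mult_ineq)
  then show "(norm (act x a))\<^sup>2 \<le> (norm x * norm a)\<^sup>2"
    by (simp add: norm_ip_self_eq[symmetric] ip_act_left ip_act_right)
      (simp add: norm_ip_self_eq power2_eq_square mult_ac)
qed simp

text \<open>With \<open>p = \<langle>x, x\<rangle> + \<langle>y, y\<rangle>\<close> and \<open>s = 2 \<langle>x, y\<rangle>\<close>, positivity of \<open>\<langle>x \<plusminus> y, x \<plusminus> y\<rangle> = p \<plusminus> s\<close> bounds the
self-adjoint element \<open>s\<close> by \<open>\<plusminus>p\<close>, hence by the norm of \<open>p\<close>.\<close>

lemma norm_ip_le_of_self_adjoint:
  assumes s: "star (ip x y) = ip x y"
  shows "2 * norm (ip x y) \<le> (norm x)\<^sup>2 + (norm y)\<^sup>2"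
proof -
  define p where "p = ip x x + ip y y"
  define s where "s = 2 *\<^sub>R ip x y"
  define r where "r = (norm x)\<^sup>2 + (norm y)\<^sup>2"
  have add_left: "ip (u + v) w = ip u w + ip v w" for u v w
    by (metis ip_add_right star_add star_ip)
  have diff_right: "ip u (v - w) = ip u v - ip u w" for u v w
    using ip_add_right[of u "v - w" w] by simp
  have diff_left: "ip (u - v) w = ip u w - ip v w" for u v w
    using add_left[of "u - v" v w] by simp
  have yx: "ip y x = ip x y" using assms star_ip by metis
  have "ip (x + y) (x + y) = p + s" "ip (x - y) (x - y) = p - s"
    unfolding p_def s_def
    by (simp_all add: add_left ip_add_right diff_left diff_right yx scaleR_2)
  then have pos: "pos_elem (p + s)" "pos_elem (p - s)"
    by (metis cstar_positive_imp_pos_elem ip_self_positive)+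
  have star_s: "star s = s" "star p = p"
    by (simp_all add: s_def p_def scaleR_scaleC star_scaleC star_add star_ip yx)
  have "norm p \<le> r"
    unfolding p_def r_def by (rule norm_triangle_mono) (simp_all add: norm_ip_self_eq)
  have r0: "r \<ge> 0" by (simp add: r_def)
  have p_le: "norm (p * a) \<le> r * norm a" for a
    by (rule order_trans[OF norm_mult_ineq]) (simp add: mult_right_mono \<open>norm p \<le> r\<close>)
  have rp: "alg.posop (\<lambda>a. r *\<^sub>R a - p * a)"
    by (rule alg.posop_of_norm_diff_le[OF _ r0])
      (use p_le star_s in \<open>simp_all add: alg.symm_diff alg.symm_scaleR_id symm_mult_left\<close>)
  have "norm s \<le> r"
  proof (rule norm_le_of_mult_left[OF r0], rule alg.norm_symm_le_of_posop[OF _ r0])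
    show "alg.symm ((*) s)" by (rule symm_mult_left[OF star_s(1)])
    show "alg.posop (\<lambda>a. r *\<^sub>R a - s * a)"
      using alg.posop_add[OF rp pos(2)[unfolded pos_elem_def]] by (simp add: algebra_simps)
    show "alg.posop (\<lambda>a. r *\<^sub>R a + s * a)"
      using alg.posop_add[OF rp pos(1)[unfolded pos_elem_def]] by (simp add: algebra_simps)
  qed
  then show ?thesis by (simp add: s_def r_def)
qed

text \<open>Replacing \<open>y\<close> by a multiple of \<open>y a\<^sup>*\<close> with \<open>a = \<langle>x, y\<rangle>\<close> makes the inner product the
self-adjoint element \<open>a a\<^sup>*\<close>, up to a positive factor, so that the previous lemma applies.\<close>

lemma ip_Cauchy_Schwarz: "norm (ip x y) \<le> norm x * norm y"
proof (cases "ip x y = 0")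
  case False
  define a where "a = ip x y"
  have a: "norm a > 0" using False by (simp add: a_def)
  have y: "norm y > 0"
    using False ip_scaleC_right[of x 0 y] ip_scaleC_right[of x 0 0] by (cases "y = 0") auto
  \<comment> \<open>This factor makes \<open>\<parallel>y t a\<^sup>*\<parallel> \<le> \<parallel>x\<parallel>\<close>, which balances the two squares.\<close>
  define t where "t = norm x / (norm y * norm a)"
  define y' where "y' = act y (t *\<^sub>R star a)"
  have t: "t \<ge> 0" by (simp add: t_def)
  have ip_y': "ip x y' = t *\<^sub>R (a * star a)" by (simp add: y'_def ip_act_right a_def)
  have "2 * norm (ip x y') \<le> (norm x)\<^sup>2 + (norm y')\<^sup>2"
    by (rule norm_ip_le_of_self_adjoint)
      (simp add: ip_y' scaleR_scaleC star_scaleC star_mult star_star)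
  moreover have "norm (a * star a) = norm a * norm a"
    using cstar_identity[of "star a"] by (simp add: star_star power2_eq_square)
  then have "norm (ip x y') = t * (norm a * norm a)" by (simp add: ip_y' t)
  then have "norm (ip x y') = norm x * norm a / norm y" using a y by (simp add: t_def)
  moreover have "norm y' \<le> norm x"
    using norm_act_le[of y "t *\<^sub>R star a"] a y t by (simp add: y'_def t_def)
  then have "(norm y')\<^sup>2 \<le> (norm x)\<^sup>2" by (intro power_mono) auto
  ultimately have "norm x * norm a / norm y \<le> norm x * norm x" by (simp add: power2_eq_square)
  then have "norm x * norm a \<le> norm x * (norm x * norm y)" using y by (simp add: field_simps)
  moreover have "norm x > 0"
  proof -
    have "ip y 0 = 0" using ip_scaleC_right[of y 0 0] by simp
    then have "ip 0 y = 0" by (metis star_ip star_zero)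
    then show ?thesis using False by (cases "x = 0") auto
  qed
  ultimately show ?thesis by (simp add: a_def)
qed simp

sublocale form: cstar_form ip
  by unfold_locales
    (simp_all add: ip_add_right ip_scaleC_right star_ip norm_ip_self_eq ip_Cauchy_Schwarz)

section \<open>Positive operators and their quadratic forms\<close>

text \<open>For every symmetric contraction \<open>X\<close>,
\<open>\<langle>z, z\<rangle> - \<langle>z, X z\<rangle> = \<langle>z - X z, z - X z\<rangle> / 2 + (\<langle>z, z\<rangle> - \<langle>z, X\<^sup>2 z\<rangle>) / 2\<close>. The first summand is
positive, and the second has the same form with the contraction \<open>X\<^sup>2\<close> in place of \<open>X\<close>. Hence
each step halves the trivial error \<open>2 \<parallel>z\<parallel>\<^sup>2\<close> that makes the expression positive.\<close>

lemma posop_quadratic_form_contraction: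
  assumes "form.symm X" "\<And>x. norm (X x) \<le> norm x"
  shows "alg.posop (\<lambda>a. (ip z z - ip z (X z)) * a + (2 * (norm z)\<^sup>2 / 2 ^ n) *\<^sub>R a)"
  using assms
proof (induction n arbitrary: X)
  case 0
  let ?r = "2 * (norm z)\<^sup>2"
  let ?b = "ip z z - ip z (X z)"
  have "norm (ip z (X z)) \<le> norm z * norm z"
    by (rule order_trans[OF ip_Cauchy_Schwarz mult_left_mono[OF 0(2)]]) simp
  then have b: "norm ?b \<le> ?r"
    using norm_triangle_ineq4[of "ip z z" "ip z (X z)"] by (simp add: norm_ip_self_eq power2_eq_square)
  have star_b: "star ?b = ?b"
    using form.symmD[OF 0(1), of z z] by (simp add: star_diff star_ip)
  have "alg.posop (\<lambda>a. ?b * a + ?r *\<^sub>R a)"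
  proof (rule alg.posop_of_norm_diff_le)
    show "alg.symm (\<lambda>a. ?b * a + ?r *\<^sub>R a)"
      by (intro alg.symm_add symm_mult_left alg.symm_scaleR_id star_b)
    show "0 \<le> ?r" by simp
    show "norm (?r *\<^sub>R a - (?b * a + ?r *\<^sub>R a)) \<le> ?r * norm a" for a
      using order_trans[OF norm_mult_ineq[of ?b a] mult_right_mono[OF b norm_ge_zero[of a]]] by simp
  qed
  then show ?case by simp
next
  case (Suc n)
  define e where "e = 2 * (norm z)\<^sup>2 / 2 ^ n"
  let ?X2 = "\<lambda>x. X (X x)"
  let ?b = "ip z z - ip z (X (X z))"
  let ?w = "ip (z - X z) (z - X z)"
  have X2: "form.symm ?X2" using Suc.prems(1) by (simp add: form.symm_def)
  have X2_le: "norm (X (X x)) \<le> norm x" for x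
    by (rule order_trans[OF Suc.prems(2) Suc.prems(2)])
  have 1: "alg.posop (\<lambda>a. ?b * a + e *\<^sub>R a)" unfolding e_def by (rule Suc.IH[OF X2 X2_le])
  have 2: "alg.posop (\<lambda>a. ?w * a)"
    using cstar_positive_imp_pos_elem[OF ip_self_positive] by (simp add: pos_elem_def)
  have w: "?w = ip z z - 2 *\<^sub>R ip z (X z) + ip z (X (X z))"
    using form.symmD[OF Suc.prems(1)] by (simp add: form.ip_simps scaleR_2)
  have "alg.posop (\<lambda>a. (1 / 2) *\<^sub>R (?w * a + (?b * a + e *\<^sub>R a)))"
    by (intro alg.posop_scaleR alg.posop_add 1 2) simp
  moreover have "(1 / 2) *\<^sub>R (?w * a + (?b * a + e *\<^sub>R a)) = (ip z z - ip z (X z)) * a + (e / 2) *\<^sub>R a"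
    for a
  proof -
    have "?w * a + ?b * a = (?w + ?b) * a" by (rule distrib_right[symmetric])
    also have "?w + ?b = 2 *\<^sub>R (ip z z - ip z (X z))" unfolding w by (simp add: scaleR_2)
    finally have "?w * a + ?b * a = 2 *\<^sub>R ((ip z z - ip z (X z)) * a)" by simp
    then have "?w * a + (?b * a + e *\<^sub>R a) = 2 *\<^sub>R ((ip z z - ip z (X z)) * a) + e *\<^sub>R a"
      by (simp add: add.assoc[symmetric])
    then show ?thesis by (simp only: scaleR_add_right scaleR_scaleR) simp
  qed
  moreover have "e / 2 = 2 * (norm z)\<^sup>2 / 2 ^ Suc n" by (simp add: e_def)
  ultimately show ?case by simp
qed

lemma pos_elem_quadratic_form_contraction:
  assumes X: "form.symm X" "\<And>x. norm (X x) \<le> norm x"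
  shows "pos_elem (ip z z - ip z (X z))"
  unfolding pos_elem_def
proof (rule alg.posop_of_posop_add_scaleR)
  let ?b = "ip z z - ip z (X z)"
  show "alg.symm ((*) ?b)"
    by (rule symm_mult_left) (use form.symmD[OF X(1), of z z] in \<open>simp add: star_diff star_ip\<close>)
  fix e :: real assume e: "e > 0"
  have "(\<lambda>n. 2 * (norm z)\<^sup>2 * (1 / 2) ^ n) \<longlonglongrightarrow> 2 * (norm z)\<^sup>2 * 0"
    by (intro tendsto_mult tendsto_const LIMSEQ_realpow_zero) simp_all
  then have "eventually (\<lambda>n. 2 * (norm z)\<^sup>2 * (1 / 2) ^ n < e) sequentially"
    using e by (intro order_tendstoD(2)) simp_all
  then obtain n where n: "2 * (norm z)\<^sup>2 / 2 ^ n < e"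
    by (auto simp: eventually_sequentially power_divide)
  have "alg.posop (\<lambda>a. ?b * a + (2 * (norm z)\<^sup>2 / 2 ^ n) *\<^sub>R a + (e - 2 * (norm z)\<^sup>2 / 2 ^ n) *\<^sub>R a)"
    by (intro alg.posop_add posop_quadratic_form_contraction X alg.posop_scaleR_id) (use n in simp)
  then show "alg.posop (\<lambda>a. ?b * a + e *\<^sub>R a)"
    by (simp add: add.assoc flip: scaleR_add_left)
qed

text \<open>A positive operator \<open>D\<close> bounded by \<open>r\<close> is \<open>r (1 - X)\<close> with a symmetric contraction \<open>X\<close>.
This replaces the usual argument through the square root of \<open>D\<close>.\<close>

lemma pos_elem_ip_posop:
  assumes D: "form.posop D"
  shows "pos_elem (ip z (D z))"
proof -
  obtain r where r: "r > 0" "\<And>x. norm (D x) \<le> r * norm x"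
    using form.symm_bound_ex[OF form.posop_symm[OF D]] by blast
  define X where "X x = (1 / r) *\<^sub>R (r *\<^sub>R x - D x)" for x
  have X: "form.symm X"
    unfolding X_def by (intro form.symm_scaleR form.symm_diff form.symm_scaleR_id form.posop_symm D)
  have X_le: "norm (X x) \<le> norm x" for x
  proof -
    have "norm (X x) = (1 / r) * norm (r *\<^sub>R x - D x)"
      unfolding X_def norm_scaleR using r(1) by simp
    also have "\<dots> \<le> (1 / r) * (r * norm x)"
      using r(1) by (intro mult_left_mono form.posop_norm_diff_le[OF D _ r(2)]) auto
    finally show ?thesis using r(1) by simp
  qed
  have "pos_elem (r *\<^sub>R (ip z z - ip z (X z)))"
    using pos_elem_quadratic_form_contraction[OF X X_le] r(1) by (intro pos_elem_scaleR) auto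
  moreover have "r *\<^sub>R (ip z z - ip z (X z)) = ip z (D z)"
    using r(1) by (simp add: X_def form.ip_simps scaleR_diff_right)
  ultimately show ?thesis by simp
qed

text \<open>The inverse of \<open>A - z\<close> is adjointable because its adjoint can be written down: it is the inverse
of \<open>A - cnj z\<close>.\<close>

lemma op_positive_iff_posop: "op_positive ip A \<longleftrightarrow> form.posop A"
proof
  assume A: "op_positive ip A"
  then obtain S where S: "is_adjoint ip ip A S"
    by (auto simp: op_positive_def adjointable_ops_def)
  have "S' = S" if "is_adjoint ip ip A S'" for S'
  proof
    fix x show "S' x = S x"
      by (rule form.ip_right_eqI) (use S that in \<open>simp add: is_adjoint_def\<close>)
  qed
  then have "adjoint_op ip ip A = S" unfolding adjoint_op_def using S by blast
  then have symm: "form.symm A"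
    using S A by (simp add: op_positive_def is_adjoint_def form.symm_def)
  show "form.posop A"
    unfolding form.posop_def
  proof (intro conjI allI impI symm)
    fix s :: real assume s: "s > 0"
    have "complex_of_real (- s) \<notin> \<real>\<^sub>\<ge>\<^sub>0" using s by (simp only: nonneg_Reals_of_real_iff)
    then have "complex_of_real (- s) \<notin> op_spectrum ip A"
      using A unfolding op_positive_def by blast
    then obtain R where "R \<circ> (\<lambda>x. A x - complex_of_real (- s) *\<^sub>C x) = id"
        "(\<lambda>x. A x - complex_of_real (- s) *\<^sub>C x) \<circ> R = id"
      unfolding op_spectrum_def by blast
    then have "bij (\<lambda>x. A x - complex_of_real (- s) *\<^sub>C x)" by (rule o_bij)
    then show "bij (\<lambda>x. A x + s *\<^sub>R x)" by (simp add: scaleR_scaleC scaleC_minus_left)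
  qed
next
  assume A: "form.posop A"
  have symm: "form.symm A" by (rule form.posop_symm[OF A])
  then have adj: "is_adjoint ip ip A A" by (simp add: is_adjoint_def form.symm_def)
  have "S' = A" if "is_adjoint ip ip A S'" for S'
  proof
    fix x show "S' x = A x"
      by (rule form.ip_right_eqI) (use adj that in \<open>simp add: is_adjoint_def\<close>)
  qed
  then have adj_eq: "adjoint_op ip ip A = A" unfolding adjoint_op_def using adj by blast
  have bij: "bij (\<lambda>x. A x - z *\<^sub>C x)" if "z \<notin> \<real>\<^sub>\<ge>\<^sub>0" for z
  proof (cases "Im z = 0")
    case True
    define s where "s = - Re z"
    have z: "z = complex_of_real (- s)" using True by (simp add: s_def complex_eq_iff)
    have "s > 0" using that by (simp add: z del: of_real_minus)
    from form.posop_bij[OF A this] show ?thesis by (simp add: z scaleR_scaleC scaleC_minus_left)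
  next
    case False
    have "(\<lambda>x. A x - z *\<^sub>C x) = uminus \<circ> (\<lambda>x. z *\<^sub>C x - A x)" by (simp add: fun_eq_iff)
    then show ?thesis using bij_comp[OF form.bij_nonreal_diff[OF symm False] bij_uminus] by simp
  qed
  have "z \<notin> op_spectrum ip A" if z: "z \<notin> \<real>\<^sub>\<ge>\<^sub>0" for z
  proof -
    let ?P = "\<lambda>x. A x - z *\<^sub>C x" and ?Q = "\<lambda>x. A x - cnj z *\<^sub>C x"
    have "cnj z \<notin> \<real>\<^sub>\<ge>\<^sub>0" using z by (simp add: complex_nonneg_Reals_iff)
    then have Q: "bij ?Q" by (rule bij)
    have P: "bij ?P" by (rule bij[OF z])
    have PQ: "ip (?P x) y = ip x (?Q y)" for x y
      using form.symmD[OF symm] by (simp add: form.ip_simps)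
    have "is_adjoint ip ip (inv ?P) (inv ?Q)"
      unfolding is_adjoint_def
    proof (intro allI)
      fix x y
      have "ip (?P (inv ?P x)) (inv ?Q y) = ip (inv ?P x) (?Q (inv ?Q y))" by (rule PQ)
      then show "ip (inv ?P x) y = ip x (inv ?Q y)"
        using surj_f_inv_f[OF bij_is_surj[OF P], of x] surj_f_inv_f[OF bij_is_surj[OF Q], of y]
        by simp
    qed
    then have "inv ?P \<in> adjointable_ops ip ip" by (auto simp: adjointable_ops_def)
    moreover have "inv ?P \<circ> ?P = id" using P by (simp add: bij_is_inj)
    moreover have "?P \<circ> inv ?P = id" using bij_is_surj[OF P] unfolding surj_iff .
    ultimately show ?thesis unfolding op_spectrum_def by blast
  qed
  then show "op_positive ip A"
    using adj adj_eq by (auto simp: op_positive_def adjointable_ops_def)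
qed

text \<open>Monotonicity of the norm gives \<open>t \<parallel>x\<parallel> \<le> \<parallel>(B + t) x\<parallel>\<close> for all \<open>t > 0\<close>. For large \<open>t\<close> the
operator \<open>C = B + t\<close> is invertible, with an inverse of norm at most \<open>1 / t\<close>; then
\<open>B + s = (1 - (t - s) C\<^sup>-\<^sup>1) C\<close> is invertible for all \<open>s\<close> with \<open>0 < s < t\<close>.\<close>

lemma posop_of_pos_elem_ip:
  assumes B: "form.symm B" and pos: "\<And>z. pos_elem (ip z (B z))"
  shows "form.posop B"
  unfolding form.posop_def
proof (intro conjI allI impI B)
  fix s :: real assume s: "s > 0"
  obtain r where r: "r > 0" "\<And>x. norm (B x) \<le> r * norm x"
    using form.symm_bound_ex[OF B] by blast
  \<comment> \<open>Any \<open>t\<close> above both \<open>r\<close> and \<open>s\<close> would do: the Neumann series inverts \<open>B + t\<close>.\<close>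
  define t where "t = r + s"
  have t: "t > 0" "t > r" "t > s" using r s by (simp_all add: t_def)
  define C where "C x = B x + t *\<^sub>R x" for x
  have C: "form.symm C" unfolding C_def by (intro form.symm_add form.symm_scaleR_id B)
  have "form.symm (\<lambda>x. 0 *\<^sub>R x - B x)" by (intro form.symm_diff form.symm_scaleR_id B)
  then have "bij (\<lambda>x. t *\<^sub>R x - (0 *\<^sub>R x - B x))"
    by (intro form.bij_scaleR_diff[OF form.symm_bounded_linear, where c = r]) (use r t in auto)
  then have bij_C: "bij C" by (simp add: C_def[abs_def] add.commute)
  have below: "t * norm x \<le> norm (C x)" for x
  proof (cases "x = 0")
    case False
    have "t * norm x * norm x = norm (t *\<^sub>R ip x x)"
      using t by (simp add: norm_ip_self_eq power2_eq_square)
    also have "\<dots> \<le> norm (t *\<^sub>R ip x x + ip x (B x))"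
      by (intro pos_elem_norm_le_add pos_elem_scaleR pos cstar_positive_imp_pos_elem ip_self_positive)
        (use t in simp)
    also have "t *\<^sub>R ip x x + ip x (B x) = ip x (C x)" by (simp add: C_def form.ip_simps)
    also have "norm (ip x (C x)) \<le> norm (C x) * norm x"
      using ip_Cauchy_Schwarz[of x "C x"] by (simp add: mult.commute)
    finally show ?thesis using False by simp
  qed simp
  define W where "W x = (t - s) *\<^sub>R inv C x" for x
  have "norm (W x) \<le> (t - s) / t * norm x" for x
  proof -
    have "t * norm (inv C x) \<le> norm x"
      using below[of "inv C x"] surj_f_inv_f[OF bij_is_surj[OF bij_C]] by simp
    then have "norm (inv C x) \<le> norm x / t" using t by (simp add: field_simps)
    then have "(t - s) * norm (inv C x) \<le> (t - s) * (norm x / t)"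
      using t by (intro mult_left_mono) auto
    then show ?thesis using t by (simp add: W_def)
  qed
  then have bij_W: "bij (\<lambda>x. 1 *\<^sub>R x - W x)"
    unfolding W_def
    by (intro form.bij_scaleR_diff[where c = "(t - s) / t"] form.symm_bounded_linear form.symm_scaleR
        form.symm_inv C bij_C) (use s t in auto)
  have "(\<lambda>x. 1 *\<^sub>R x - W x) \<circ> C = (\<lambda>x. B x + s *\<^sub>R x)"
    using bij_C by (simp add: fun_eq_iff W_def bij_is_inj C_def[symmetric])
      (simp add: C_def algebra_simps)
  then show "bij (\<lambda>x. B x + s *\<^sub>R x)" using bij_comp[OF bij_C bij_W] by simp
qed

end

section \<open>Comparing the operators\<close>

text \<open>Jacobson's lemma: \<open>1 - a b\<close> is invertible if \<open>1 - b a\<close> is, here with \<open>a = C\<^sup>-\<^sup>1 F\<close> and \<open>b = G\<close>.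
A solution \<open>v\<close> of \<open>C v - F (G v) = y\<close> is determined by \<open>w = G v\<close>, which solves an equation for
\<open>1 - G C\<^sup>-\<^sup>1 F\<close>.\<close>

lemma bij_diff_comp_of_bij:
  fixes C :: "'k::ab_group_add \<Rightarrow> 'k" and F :: "'h::ab_group_add \<Rightarrow> 'k" and G :: "'k \<Rightarrow> 'h"
  assumes C: "bij C"
    and add: "\<And>x y. inv C (x + y) = inv C x + inv C y" "\<And>x y. G (x + y) = G x + G y"
    and bij: "bij (\<lambda>x. x - G (inv C (F x)))"
  shows "bij (\<lambda>v. C v - F (G v))"
  unfolding bij_iff
proof
  fix y
  have C_inv: "C (inv C x) = x" "inv C (C v) = v" for x v
    using C by (simp_all add: bij_is_inj bij_is_surj surj_f_inv_f)
  obtain w where w: "w - G (inv C (F w)) = G (inv C y)"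
      and w_unique: "\<And>w'. w' - G (inv C (F w')) = G (inv C y) \<Longrightarrow> w' = w"
    using bij unfolding bij_iff by metis
  show "\<exists>!v. C v - F (G v) = y"
  proof
    have "G (inv C (y + F w)) = w" using w by (simp add: add algebra_simps)
    then show "C (inv C (y + F w)) - F (G (inv C (y + F w))) = y" by (simp add: C_inv)
  next
    fix v assume "C v - F (G v) = y"
    then have v: "v = inv C (y + F (G v))" by (metis C_inv(2) diff_add_cancel)
    then have "G v = G (inv C y) + G (inv C (F (G v)))" by (metis add)
    then have "G v = w" by (intro w_unique) (simp add: algebra_simps)
    with v show "v = inv C (y + F w)" by simp
  qed
qed

lemma (in hilbert_module) is_adjoint_adjoint_op:
  assumes "T \<in> adjointable_ops ip ip'"
  shows "is_adjoint ip ip' T (adjoint_op ip ip' T)"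
proof -
  obtain S where S: "is_adjoint ip ip' T S" using assms by (auto simp: adjointable_ops_def)
  have "S' = S" if "is_adjoint ip ip' T S'" for S'
  proof
    fix x show "S' x = S x"
      by (rule form.ip_right_eqI) (use S that in \<open>simp add: is_adjoint_def\<close>)
  qed
  then show ?thesis unfolding adjoint_op_def using S by (metis theI)
qed

lemma is_adjoint_swap:
  assumes "hilbert_module actH ipH" "hilbert_module actK ipK" "is_adjoint ipH ipK T S"
  shows "is_adjoint ipK ipH S T"
  unfolding is_adjoint_def
proof (intro allI)
  fix x y
  have "star (ipH y (S x)) = star (ipK (T y) x)" using assms(3) by (simp add: is_adjoint_def)
  then show "ipH (S x) y = ipK x (T y)"
    by (simp only: hilbert_module.star_ip[OF assms(1)] hilbert_module.star_ip[OF assms(2)])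
qed

text \<open>The element \<open>\<lambda>\<langle>Sz, Sz\<rangle>\<close> exceeds \<open>\<langle>S'z, S'z\<rangle>\<close> by the positive element \<open>\<langle>z, (\<lambda>B - A)z\<rangle>\<close>.\<close>

lemma norm_adjoint_le_of_posop:
  assumes E: "hilbert_module actE ipE" and H: "hilbert_module actH ipH"
    and K: "hilbert_module actK ipK"
    and TS: "is_adjoint ipE ipK T S" and TS': "is_adjoint ipH ipK T' S'"
    and l: "l > 0" and pos: "cstar_form.posop ipK (\<lambda>z. l *\<^sub>R T (S z) - T' (S' z))"
  shows "norm (S' z) \<le> sqrt l * norm (S z)"
proof -
  interpret E: hilbert_module actE ipE by (rule E)
  interpret H: hilbert_module actH ipH by (rule H)
  interpret K: hilbert_module actK ipK by (rule K)
  let ?a = "ipH (S' z) (S' z)" and ?b = "ipK z (l *\<^sub>R T (S z) - T' (S' z))"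
  have ST: "is_adjoint ipK ipE S T" "is_adjoint ipK ipH S' T'"
    using is_adjoint_swap[OF E K TS] is_adjoint_swap[OF H K TS'] .
  have "(norm (S' z))\<^sup>2 = norm ?a" by (rule H.norm_ip_self_eq[symmetric])
  also have "\<dots> \<le> norm (?a + ?b)"
    by (intro pos_elem_norm_le_add K.pos_elem_ip_posop pos cstar_positive_imp_pos_elem
        H.ip_self_positive)
  also have "?a + ?b = l *\<^sub>R ipE (S z) (S z)"
    using ST by (simp add: K.form.ip_simps is_adjoint_def)
  also have "norm \<dots> = (sqrt l * norm (S z))\<^sup>2"
    using l by (simp add: E.norm_ip_self_eq power_mult_distrib)
  finally show ?thesis by (rule power2_le_imp_le) (use l in simp)
qed

text \<open>The operator \<open>\<lambda>B - A + s = C - T' S'\<close> is inverted by transferring the problem to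
\<open>W = S' C\<^sup>-\<^sup>1 T'\<close> on \<open>H\<close>. The norm of \<open>W\<close> can be estimated by a norm inequality for vectors
alone, because \<open>\<langle>u, Cu\<rangle> = \<langle>Wx, x\<rangle>\<close> for \<open>u = C\<^sup>-\<^sup>1 T' x\<close>.\<close>

lemma posop_of_norm_adjoint_le:
  assumes E: "hilbert_module actE ipE" and H: "hilbert_module actH ipH"
    and K: "hilbert_module actK ipK"
    and TS: "is_adjoint ipE ipK T S" and TS': "is_adjoint ipH ipK T' S'"
    and le: "\<And>z. norm (S' z) \<le> \<mu> * norm (S z)" and l: "l > \<mu>\<^sup>2"
  shows "cstar_form.posop ipK (\<lambda>z. l *\<^sub>R T (S z) - T' (S' z))"
proof -
  interpret E: hilbert_module actE ipE by (rule E)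
  interpret H: hilbert_module actH ipH by (rule H)
  interpret K: hilbert_module actK ipK by (rule K)
  have ST: "is_adjoint ipK ipE S T" "is_adjoint ipK ipH S' T'"
    using is_adjoint_swap[OF E K TS] is_adjoint_swap[OF H K TS'] .
  have l0: "l > 0" using l zero_le_power2[of \<mu>] by linarith
  have symm_B: "K.form.symm (\<lambda>z. T (S z))" and symm_A: "K.form.symm (\<lambda>z. T' (S' z))"
    using TS TS' ST by (simp_all add: K.form.symm_def is_adjoint_def)
  have B: "K.form.posop (\<lambda>z. T (S z))"
  proof (rule K.posop_of_pos_elem_ip[OF symm_B])
    fix z
    have "pos_elem (ipE (S z) (S z))" by (intro cstar_positive_imp_pos_elem E.ip_self_positive)
    also have "ipE (S z) (S z) = ipK z (T (S z))" using ST by (simp add: is_adjoint_def)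
    finally show "pos_elem (ipK z (T (S z)))" .
  qed
  show ?thesis
    unfolding K.form.posop_def
  proof (intro conjI allI impI)
    show "K.form.symm (\<lambda>z. l *\<^sub>R T (S z) - T' (S' z))"
      by (intro K.form.symm_diff K.form.symm_scaleR symm_A symm_B)
  next
    fix s :: real assume s: "s > 0"
    define C where "C z = l *\<^sub>R T (S z) + s *\<^sub>R z" for z
    have lB: "K.form.posop (\<lambda>z. l *\<^sub>R T (S z))" using B l0 by (intro K.form.posop_scaleR) auto
    have C: "K.form.symm C"
      unfolding C_def by (intro K.form.symm_add K.form.symm_scaleR K.form.symm_scaleR_id symm_B)
    have bij_C: "bij C" using K.form.posop_bij[OF lB s] by (simp add: C_def[abs_def])
    have R: "K.form.symm (inv C)" by (rule K.form.symm_inv[OF C bij_C])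
    define W where "W x = S' (inv C (T' x))" for x
    have W: "H.form.symm W"
      unfolding H.form.symm_def W_def
    proof (intro allI)
      fix x y
      have "ipH (S' (inv C (T' x))) y = ipK (inv C (T' x)) (T' y)"
        using ST by (simp add: is_adjoint_def)
      also have "\<dots> = ipK (T' x) (inv C (T' y))" by (rule K.form.symmD[OF R])
      also have "\<dots> = ipH x (S' (inv C (T' y)))" using TS' by (simp add: is_adjoint_def)
      finally show "ipH (S' (inv C (T' x))) y = ipH x (S' (inv C (T' y)))" .
    qed
    have W_le: "norm (W x) \<le> \<mu>\<^sup>2 / l * norm x" for x
    proof (cases "W x = 0")
      case True
      then show ?thesis using l0 by simp
    next
      case False
      define u where "u = inv C (T' x)"
      have Cu: "C u = T' x" using bij_C by (simp add: u_def bij_is_surj surj_f_inv_f)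
      have Wx: "W x = S' u" by (simp add: W_def u_def)
      have "l * (norm (S u))\<^sup>2 = norm (l *\<^sub>R ipE (S u) (S u))"
        using l0 by (simp add: E.norm_ip_self_eq)
      also have "\<dots> \<le> norm (l *\<^sub>R ipE (S u) (S u) + s *\<^sub>R ipK u u)"
        by (intro pos_elem_norm_le_add pos_elem_scaleR cstar_positive_imp_pos_elem
            E.ip_self_positive K.ip_self_positive) (use l0 s in auto)
      also have "l *\<^sub>R ipE (S u) (S u) + s *\<^sub>R ipK u u = ipK u (C u)"
        using ST by (simp add: C_def K.form.ip_simps is_adjoint_def)
      also have "\<dots> = ipH (W x) x" using ST by (simp add: Cu Wx is_adjoint_def)
      also have "norm \<dots> \<le> norm (W x) * norm x" by (rule H.ip_Cauchy_Schwarz)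
      finally have Su: "l * (norm (S u))\<^sup>2 \<le> norm (W x) * norm x" .
      have "(norm (W x))\<^sup>2 \<le> (\<mu> * norm (S u))\<^sup>2"
        unfolding Wx by (intro power_mono le) simp
      then have "l * (norm (W x))\<^sup>2 \<le> \<mu>\<^sup>2 * (l * (norm (S u))\<^sup>2)"
        using l0 by (simp add: power_mult_distrib)
      also have "\<dots> \<le> \<mu>\<^sup>2 * (norm (W x) * norm x)" by (intro mult_left_mono Su) simp
      finally have "(l * norm (W x)) * norm (W x) \<le> (\<mu>\<^sup>2 * norm x) * norm (W x)"
        by (simp add: power2_eq_square mult_ac)
      then have "l * norm (W x) \<le> \<mu>\<^sup>2 * norm x" using False by simp
      then show ?thesis using l0 by (simp add: field_simps)
    qed
    have "bij (\<lambda>x. 1 *\<^sub>R x - W x)"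
      by (rule H.form.bij_scaleR_diff[OF H.form.symm_bounded_linear[OF W] _ W_le])
        (use l l0 in simp_all)
    then have bij_W: "bij (\<lambda>x. x - S' (inv C (T' x)))" by (simp add: W_def)
    have S'_add: "S' (x + y) = S' x + S' y" for x y
    proof (rule H.form.ip_right_eqI)
      fix z
      have "ipH z (S' v) = ipK (T' z) v" for v using TS' by (simp add: is_adjoint_def)
      then show "ipH z (S' (x + y)) = ipH z (S' x + S' y)"
        by (simp only: H.ip_add_right K.ip_add_right)
    qed
    have "bij (\<lambda>z. C z - T' (S' z))"
      by (rule bij_diff_comp_of_bij[OF bij_C K.form.symm_maps_add[OF R] S'_add bij_W])
    then show "bij (\<lambda>z. l *\<^sub>R T (S z) - T' (S' z) + s *\<^sub>R z)"
      by (simp add: C_def algebra_simps)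
  qed
qed

theorem corollary2p5:
  fixes actE :: "'e::{complex_vector,banach} \<Rightarrow> 'a::cstar_algebra \<Rightarrow> 'e"
    and ipE :: "'e \<Rightarrow> 'e \<Rightarrow> 'a"
    and actH :: "'h::{complex_vector,banach} \<Rightarrow> 'a \<Rightarrow> 'h"
    and ipH :: "'h \<Rightarrow> 'h \<Rightarrow> 'a"
    and actK :: "'k::{complex_vector,banach} \<Rightarrow> 'a \<Rightarrow> 'k"
    and ipK :: "'k \<Rightarrow> 'k \<Rightarrow> 'a"
    and T :: "'e \<Rightarrow> 'k" and T' :: "'h \<Rightarrow> 'k"
  assumes "hilbert_module actE ipE"
    and "hilbert_module actH ipH"
    and "hilbert_module actK ipK"
    and "T \<in> adjointable_ops ipE ipK"
    and "T' \<in> adjointable_ops ipH ipK"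
  shows "(\<exists>l::real. l > 0 \<and>
            op_le ipK (T' \<circ> adjoint_op ipH ipK T') (\<lambda>z. l *\<^sub>R (T \<circ> adjoint_op ipE ipK T) z))
     \<longleftrightarrow> (\<exists>\<mu>::real. \<mu> > 0 \<and>
            (\<forall>z. norm (adjoint_op ipH ipK T' z) \<le> \<mu> * norm (adjoint_op ipE ipK T z)))"
proof -
  let ?S = "adjoint_op ipE ipK T" and ?S' = "adjoint_op ipH ipK T'"
  have TS: "is_adjoint ipE ipK T ?S"
    by (rule hilbert_module.is_adjoint_adjoint_op[OF assms(1,4)])
  have TS': "is_adjoint ipH ipK T' ?S'"
    by (rule hilbert_module.is_adjoint_adjoint_op[OF assms(2,5)])
  have op_le: "op_le ipK (T' \<circ> ?S') (\<lambda>z. l *\<^sub>R (T \<circ> ?S) z)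
      \<longleftrightarrow> cstar_form.posop ipK (\<lambda>z. l *\<^sub>R T (?S z) - T' (?S' z))" for l
    by (simp add: op_le_def hilbert_module.op_positive_iff_posop[OF assms(3)])
  show ?thesis
    unfolding op_le
  proof
    assume "\<exists>l>0. cstar_form.posop ipK (\<lambda>z. l *\<^sub>R T (?S z) - T' (?S' z))"
    then obtain l where l: "l > 0" "cstar_form.posop ipK (\<lambda>z. l *\<^sub>R T (?S z) - T' (?S' z))"
      by blast
    have "norm (?S' z) \<le> sqrt l * norm (?S z)" for z
      by (rule norm_adjoint_le_of_posop[OF assms(1-3) TS TS' l])
    then show "\<exists>\<mu>>0. \<forall>z. norm (?S' z) \<le> \<mu> * norm (?S z)"
      using l(1) by (intro exI[of _ "sqrt l"]) auto
  next
    assume "\<exists>\<mu>>0. \<forall>z. norm (?S' z) \<le> \<mu> * norm (?S z)"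
    then obtain \<mu> where "\<And>z. norm (?S' z) \<le> \<mu> * norm (?S z)" by blast
    then have "cstar_form.posop ipK (\<lambda>z. (\<mu>\<^sup>2 + 1) *\<^sub>R T (?S z) - T' (?S' z))"
      by (rule posop_of_norm_adjoint_le[OF assms(1-3) TS TS']) simp
    moreover have "\<mu>\<^sup>2 + 1 > 0" using zero_le_power2[of \<mu>] by linarith
    ultimately show "\<exists>l>0. cstar_form.posop ipK (\<lambda>z. l *\<^sub>R T (?S z) - T' (?S' z))" by blast
  qed
qed

end
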